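(* There is a polynomial $p$ such that for every $n>1$ and every choice of functions $r,s:[n]^3\to[n]$ satisfying the guard conditions below, the set of clauses $\mathrm{GGT}_n$ has a greedy, unit-propagating, tree-like, regular w-resolution refutation with input lemmas of size at most $p(n)$.
   Context: Let $[n]=\{0,\dots,n-1\}$. Variables are $x_{i,j}$ for $i\neq j$ in $[n]$, with the convention that $x_{i,j}$ and $\overline x_{j,i}$ are the same literal. For distinct $i,j,k$, $T_{i,j,k}=\overline x_{i,j}\lor\overline x_{j,k}\lor\overline x_{k,i}$. Let $r,s:[n]^3\to[n]$ satisfy, for all distinct $i,j,k$: $r(i,j,k)\neq s(i,j,k)$, $\{r(i,j,k),s(i,j,k)\}\not\subseteq\{i,j,k\}$, and $r,s$ are invariant under cyclic permutation of $(i,j,k)$. $\mathrm{GGT}_n$ consists of the clauses $\bigvee_{j\neq i}x_{j,i}$ for each $i<n$, and for all distinct $i,j,k$ the clauses $T_{i,j,k}\lor x_{r,s}$ and $T_{i,j,k}\lor\overline x_{r,s}$ where $r=r(i,j,k)$, $s=s(i,j,k)$. w-resolution: from clauses $A,B$ and a variable $x$ with $\overline x\notin A$, $x\notin B$, infer $(A\setminus\{x\})\cup(B\setminus\{\overline x\})$; if $x\notin A$ (resp. $\overline x\notin B$) it is called a phantom literal of $A$ (resp. $B$). A tree-like regular w-resolution proof with input lemmas from a clause set $\Gamma$ is a binary tree whose internal nodes are labeled by clauses obtained by w-resolution on a specified variable from their two children, in which along every root-to-leaf path each variable is resolved on at most once, and whose leaves are labeled by clauses of $\Gamma$ or by lemmas: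 clauses labeling a node earlier in postorder (left subtree, then right subtree, then node) whose subderivation is an input derivation (every inference has a hypothesis that is in $\Gamma$ or a lemma). A refutation has root clause $\Box$ (empty). For a clause $C$ in a refutation $R$, $C^+$ is the set of literals occurring as literals or phantom literals in clauses on the path from $C$ to the root; $\Gamma(C)$ is $\Gamma$ together with every clause $D$ preceding $C$ in postorder that was derived by an input subderivation. $R$ is greedy and unit-propagating if for every clause $C$ of $R$: whenever there is an input derivation from $\Gamma(C)$ of some clause $C'\subseteq C^+$ that does not resolve on any literal of $C^+$, then $C$ is derived in $R$ by such a derivation. Size is the number of clauses.
   Formalization: Γ(C) counts only clauses preceding C in postorder that lie outside the subderivation of C; if clauses inside it counted too, every greedy refutation would be one input derivation, and none exists for n ≥ 4. *)

theory Defs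
  imports
    "HOL-Library.Sublist"
    "HOL-Computational_Algebra.Polynomial"
begin

datatype 'v lit = Pos (var: 'v) | Neg (var: 'v)

type_synonym 'v clause = "'v lit set"

primrec neg :: "'v lit \<Rightarrow> 'v lit" where
  "neg (Pos v) = Neg v"
| "neg (Neg v) = Pos v"

definition vars :: "'v clause set \<Rightarrow> 'v set" where
  "vars \<Gamma> = (\<Union>C\<in>\<Gamma>. var ` C)"

(* Resolve x A B is an inference whose left hypothesis is A and whose right hypothesis is B.
   The literal x is removed from the left hypothesis and its negation from the right one;
   x may be a negative literal, so either hypothesis may be the one losing the positive literal.
   The clause labelling an inference is determined by x and the hypotheses, so only leaves
   carry a label. *)
datatype 'v rtree = Leaf "'v clause" | Resolve "'v lit" "'v rtree" "'v rtree"

primrec concl :: "'v rtree \<Rightarrow> 'v clause" where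
  "concl (Leaf C) = C"
| "concl (Resolve x A B) = (concl A - {x}) \<union> (concl B - {neg x})"

(* Neither x \<in> concl A nor neg x \<in> concl B is required: phantom literals are allowed. *)
primrec w_resolution :: "'v set \<Rightarrow> 'v rtree \<Rightarrow> bool" where
  "w_resolution V (Leaf C) \<longleftrightarrow> True"
| "w_resolution V (Resolve x A B) \<longleftrightarrow>
     var x \<in> V \<and> neg x \<notin> concl A \<and> x \<notin> concl B \<and> w_resolution V A \<and> w_resolution V B"

primrec leaves :: "'v rtree \<Rightarrow> 'v clause set" where
  "leaves (Leaf C) = {C}"
| "leaves (Resolve x A B) = leaves A \<union> leaves B"

primrec resolved_vars :: "'v rtree \<Rightarrow> 'v set" where
  "resolved_vars (Leaf C) = {}"
| "resolved_vars (Resolve x A B) = {var x} \<union> resolved_vars A \<union> resolved_vars B"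

primrec regular :: "'v rtree \<Rightarrow> bool" where
  "regular (Leaf C) \<longleftrightarrow> True"
| "regular (Resolve x A B) \<longleftrightarrow>
     var x \<notin> resolved_vars A \<union> resolved_vars B \<and> regular A \<and> regular B"

primrec is_leaf :: "'v rtree \<Rightarrow> bool" where
  "is_leaf (Leaf C) \<longleftrightarrow> True"
| "is_leaf (Resolve x A B) \<longleftrightarrow> False"

primrec input_tree :: "'v rtree \<Rightarrow> bool" where
  "input_tree (Leaf C) \<longleftrightarrow> True"
| "input_tree (Resolve x A B) \<longleftrightarrow>
     (is_leaf A \<or> is_leaf B) \<and> input_tree A \<and> input_tree B"

definition input_derivation_from :: "'v clause set \<Rightarrow> 'v rtree \<Rightarrow> bool" where
  "input_derivation_from \<Delta> D \<longleftrightarrow>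
     w_resolution (vars \<Delta>) D \<and> input_tree D \<and> leaves D \<subseteq> \<Delta>"

definition resolves_on_none_of :: "'v lit set \<Rightarrow> 'v rtree \<Rightarrow> bool" where
  "resolves_on_none_of S D \<longleftrightarrow> resolved_vars D \<inter> var ` S = {}"

(* Nodes (clause occurrences) of a proof are addressed by the path from the root. *)
datatype side = Lft | Rgt

type_synonym pos = "side list"

primrec postorder :: "'v rtree \<Rightarrow> pos list" where
  "postorder (Leaf C) = [[]]"
| "postorder (Resolve x A B) =
     map (Cons Lft) (postorder A) @ map (Cons Rgt) (postorder B) @ [[]]"

definition positions :: "'v rtree \<Rightarrow> pos set" where
  "positions R = set (postorder R)"

definition proof_size :: "'v rtree \<Rightarrow> nat" where
  "proof_size R = length (postorder R)"

definition precedes :: "'v rtree \<Rightarrow> pos \<Rightarrow> pos \<Rightarrow> bool" where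
  "precedes R p q \<longleftrightarrow>
     (\<exists>i j. i < j \<and> j < length (postorder R) \<and> postorder R ! i = p \<and> postorder R ! j = q)"

(* Only applied to p \<in> positions R. *)
fun subtree :: "'v rtree \<Rightarrow> pos \<Rightarrow> 'v rtree" where
  "subtree R [] = R"
| "subtree (Resolve x A B) (Lft # p) = subtree A p"
| "subtree (Resolve x A B) (Rgt # p) = subtree B p"
| "subtree (Leaf C) (d # p) = Leaf C"

definition lemma_at :: "'v rtree \<Rightarrow> pos \<Rightarrow> 'v clause \<Rightarrow> bool" where
  "lemma_at R q C \<longleftrightarrow>
     (\<exists>p. precedes R p q \<and> input_tree (subtree R p) \<and> concl (subtree R p) = C)"

(* Tree-like regular w-resolution proofs with input lemmas. *)
definition regWRTI :: "'v clause set \<Rightarrow> 'v rtree \<Rightarrow> bool" where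
  "regWRTI \<Gamma> R \<longleftrightarrow>
     w_resolution (vars \<Gamma>) R \<and> regular R \<and>
     (\<forall>q\<in>positions R. \<forall>C. subtree R q = Leaf C \<longrightarrow> C \<in> \<Gamma> \<or> lemma_at R q C)"

definition regWRTI_refutation :: "'v clause set \<Rightarrow> 'v rtree \<Rightarrow> bool" where
  "regWRTI_refutation \<Gamma> R \<longleftrightarrow> regWRTI \<Gamma> R \<and> concl R = {}"

(* path_lits R q is the set C^+ for the clause C at q.  A hypothesis on the path that is resolved
   as the left (right) premise on x contains x (neg x) as a literal or as a phantom literal;
   the set C^+ gets this literal in either case. *)
fun path_lits :: "'v rtree \<Rightarrow> pos \<Rightarrow> 'v lit set" where
  "path_lits R [] = concl R"
| "path_lits (Resolve x A B) (Lft # q) = concl (Resolve x A B) \<union> {x} \<union> path_lits A q"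
| "path_lits (Resolve x A B) (Rgt # q) = concl (Resolve x A B) \<union> {neg x} \<union> path_lits B q"
| "path_lits (Leaf C) (d # q) = C"

(* The set \<Gamma>(C) for the clause C at q.  It consists of the clauses available when the derivation
   of C is begun, so nodes inside the subderivation of C, which come before C in postorder, do
   not contribute.  If they did, then any clause inferred from two hypotheses with input
   subderivations would itself have a one-step input derivation from \<Gamma>(C), and a greedy
   refutation as defined below would have to be a single input derivation. *)
definition available :: "'v clause set \<Rightarrow> 'v rtree \<Rightarrow> pos \<Rightarrow> 'v clause set" where
  "available \<Gamma> R q =
     \<Gamma> \<union> {concl (subtree R p) | p.
           precedes R p q \<and> \<not> prefix q p \<and> input_tree (subtree R p)}"

definition greedy_unit_propagating :: "'v clause set \<Rightarrow> 'v rtree \<Rightarrow> bool" where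
  "greedy_unit_propagating \<Gamma> R \<longleftrightarrow>
     (\<forall>q\<in>positions R.
        (\<exists>D. input_derivation_from (available \<Gamma> R q) D \<and>
             concl D \<subseteq> path_lits R q \<and>
             resolves_on_none_of (path_lits R q) D) \<longrightarrow>
        input_derivation_from (available \<Gamma> R q) (subtree R q) \<and>
        resolves_on_none_of (path_lits R q) (subtree R q))"

(* The literal x_{i,j}, for i \<noteq> j.  There is one variable for each unordered pair {i,j}, so that
   x_{i,j} and the negation of x_{j,i} are the same literal. *)
definition xlit :: "nat \<Rightarrow> nat \<Rightarrow> (nat \<times> nat) lit" where
  "xlit i j = (if i < j then Pos (i, j) else Neg (j, i))"

lemma neg_xlit: "i \<noteq> j \<Longrightarrow> neg (xlit i j) = xlit j i"
  by (auto simp: xlit_def)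

definition T :: "nat \<Rightarrow> nat \<Rightarrow> nat \<Rightarrow> (nat \<times> nat) clause" where
  "T i j k = {neg (xlit i j), neg (xlit j k), neg (xlit k i)}"

definition distinct_triple :: "nat \<Rightarrow> nat \<Rightarrow> nat \<Rightarrow> nat \<Rightarrow> bool" where
  "distinct_triple n i j k \<longleftrightarrow> i < n \<and> j < n \<and> k < n \<and> distinct [i, j, k]"

definition guards :: "nat \<Rightarrow> (nat \<Rightarrow> nat \<Rightarrow> nat \<Rightarrow> nat) \<Rightarrow> (nat \<Rightarrow> nat \<Rightarrow> nat \<Rightarrow> nat) \<Rightarrow> bool" where
  "guards n r s \<longleftrightarrow>
     (\<forall>i<n. \<forall>j<n. \<forall>k<n. r i j k < n \<and> s i j k < n) \<and>
     (\<forall>i j k. distinct_triple n i j k \<longrightarrow>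
        r i j k \<noteq> s i j k \<and>
        \<not> {r i j k, s i j k} \<subseteq> {i, j, k} \<and>
        r i j k = r j k i \<and> r i j k = r k i j \<and>
        s i j k = s j k i \<and> s i j k = s k i j)"

definition GGT ::
  "nat \<Rightarrow> (nat \<Rightarrow> nat \<Rightarrow> nat \<Rightarrow> nat) \<Rightarrow> (nat \<Rightarrow> nat \<Rightarrow> nat \<Rightarrow> nat) \<Rightarrow> (nat \<times> nat) clause set" where
  "GGT n r s =
     {{xlit j i | j. j < n \<and> j \<noteq> i} | i. i < n} \<union>
     {T i j k \<union> {xlit (r i j k) (s i j k)} | i j k. distinct_triple n i j k} \<union>
     {T i j k \<union> {neg (xlit (r i j k) (s i j k))} | i j k. distinct_triple n i j k}"

end

(*
  A greedy, unit-propagating refutation is a search tree whose nodes carry the set S of literals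
  falsified on the path.  A node may branch only if unit propagation finds no conflict there; at a
  conflict any input derivation of a clause contained in S may be used, and all its intermediate
  clauses become lemmas.  Phantom literals turn such a leaf into a device for learning any input-derivable
  clause whose derivation avoids the variables of S and none of whose literals is true on the path:
  its remaining unassigned literals are resolved away against a falsified clause.

  Read x_{u,v} as "u precedes v" and keep a pool of at most six vertices without a predecessor from
  which all vertices seen so far are reachable.  For three pool vertices, either each of the six
  paths a, b, c of two edges leads to a conflict, and then six leaves close the node, or some path
  does not, and closing it to a 3-cycle gives a leaf at which a wanted clause is learned, at the cost of
  three open branches with a smaller pool.  Hence lemmas that happen to produce conflicts earlier than
  expected do no harm, and the number of open branches is bounded by the number of wanted clauses.
  First the T_{i,j,k} are wanted.  Where all of them are usable, the wanted clauses are "m is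
  not the minimum of {0, ..., k - 1}", weakened by literals of S; they follow from those for k + 1 as in
  the short refutation of the unguarded principle.  Once these are known for the pool, finding the
  minimum of the pool closes the branch.
*)

theory Submission
  imports Defs
begin

section \<open>Complementary literals and consistent sets\<close>

lemma neg_neg [simp]: "neg (neg l) = l"
  by (cases l) auto

lemma var_neg [simp]: "var (neg l) = var l"
  by (cases l) auto

lemma neg_neq [simp]: "neg l \<noteq> l" "l \<noteq> neg l"
  by (cases l; simp)+

lemma var_eq_iff: "var a = var b \<longleftrightarrow> a = b \<or> a = neg b"
  by (cases a; cases b) auto

lemma var_image_iff: "var l \<in> var ` S \<longleftrightarrow> l \<in> S \<or> neg l \<in> S"
  by (auto simp: image_iff var_eq_iff) (metis neg_neg var_neg)+

definition consistent :: "'v lit set \<Rightarrow> bool" where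
  "consistent S \<longleftrightarrow> (\<forall>l\<in>S. neg l \<notin> S)"

lemma consistent_insert:
  "consistent S \<Longrightarrow> var l \<notin> var ` S \<Longrightarrow> consistent (insert l S)"
  by (auto simp: consistent_def var_image_iff)

lemma consistent_subset: "consistent S \<Longrightarrow> S' \<subseteq> S \<Longrightarrow> consistent S'"
  by (auto simp: consistent_def)

section \<open>Unit propagation\<close>

text \<open>\<open>S\<close> is the set of falsified literals.\<close>

inductive up :: "'v clause set \<Rightarrow> 'v lit set \<Rightarrow> bool" for \<Delta> where
  conflict: "C \<in> \<Delta> \<Longrightarrow> C \<subseteq> S \<Longrightarrow> up \<Delta> S"
| propagate: "C \<in> \<Delta> \<Longrightarrow> C \<subseteq> insert l S \<Longrightarrow> up \<Delta> (insert (neg l) S) \<Longrightarrow> up \<Delta> S"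

lemma up_mono: "up \<Delta> S \<Longrightarrow> \<Delta> \<subseteq> \<Delta>' \<Longrightarrow> S \<subseteq> S' \<Longrightarrow> up \<Delta>' S'"
proof (induction arbitrary: S' rule: up.induct)
  case (conflict C S)
  then show ?case by (meson up.conflict subsetD subset_trans)
next
  case (propagate C l S)
  then have "up \<Delta>' (insert (neg l) S')" by (meson insert_mono)
  then show ?case using propagate by (meson up.propagate insert_mono subsetD subset_trans)
qed

lemma up_propagate_set:
  assumes "finite X" "\<And>l. l \<in> X \<Longrightarrow> \<exists>C\<in>\<Delta>. C \<subseteq> insert l S" "up \<Delta> (S \<union> neg ` X)"
  shows "up \<Delta> S"
  using assms
proof (induction X rule: finite_induct)
  case (insert l X)
  obtain C where C: "C \<in> \<Delta>" "C \<subseteq> insert l S" using insert.prems by blast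
  have "up \<Delta> (insert (neg l) (S \<union> neg ` X))" using insert.prems(2) by simp
  moreover have "C \<subseteq> insert l (S \<union> neg ` X)" using C by auto
  ultimately have "up \<Delta> (S \<union> neg ` X)" using C(1) by (rule_tac up.propagate)
  then show ?case using insert by auto
qed auto

text \<open>Read from the conclusion towards the leaves, an input derivation is a propagation run:
  at each inference the hypothesis that is a leaf has at most the resolved literal outside
  \<open>S\<close>, so it is unit, and the run continues in the other hypothesis with the complement
  of that literal falsified.\<close>

lemma input_derivation_up:
  "input_tree D \<Longrightarrow> leaves D \<subseteq> \<Delta> \<Longrightarrow> concl D \<subseteq> S \<Longrightarrow> up \<Delta> S"
proof (induction D arbitrary: S)
  case (Leaf C)
  then show ?case by (auto intro: up.conflict)
next
  case (Resolve x A B)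
  have sub: "concl A \<subseteq> insert x S" "concl B \<subseteq> insert (neg x) S" using Resolve.prems by auto
  from Resolve.prems consider "is_leaf A" | "is_leaf B" by auto
  then show ?case
  proof cases
    case 1
    then obtain C where "A = Leaf C" by (cases A) auto
    then have "C \<in> \<Delta>" "C \<subseteq> insert x S" using Resolve.prems sub by auto
    moreover have "up \<Delta> (insert (neg x) S)" using Resolve.IH(2) Resolve.prems sub by simp
    ultimately show ?thesis by (rule up.propagate)
  next
    case 2
    then obtain C where "B = Leaf C" by (cases B) auto
    then have "C \<in> \<Delta>" "C \<subseteq> insert (neg x) S" using Resolve.prems sub by auto
    moreover have "up \<Delta> (insert (neg (neg x)) S)" using Resolve.IH(1) Resolve.prems sub by simp
    ultimately show ?thesis by (rule up.propagate)
  qed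
qed

lemma proof_size_simps [simp]:
  "proof_size (Leaf C) = 1"
  "proof_size (Resolve x A B) = Suc (proof_size A + proof_size B)"
  by (auto simp: proof_size_def)

text \<open>The trees that may be placed at a node where propagation finds a conflict;
  \<open>S\<close> is the set of literals falsified on the path to that node.\<close>

definition derivation :: "'v set \<Rightarrow> 'v clause set \<Rightarrow> 'v lit set \<Rightarrow> 'v rtree \<Rightarrow> bool" where
  "derivation V \<Delta> S D \<longleftrightarrow> w_resolution V D \<and> regular D \<and> input_tree D \<and> leaves D \<subseteq> \<Delta> \<and>
     resolved_vars D \<inter> var ` S = {}"

text \<open>Converse of \<open>input_derivation_up\<close>: the propagation steps become the spine
  of the derivation. Steps whose literal is already assigned are skipped, so each inference uses a
  new variable outside \<open>S\<close>. This gives regularity and the bound: two clauses per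
  inference and one for the last leaf.\<close>

lemma up_derivation:
  assumes "up \<Delta> S" "consistent S" "finite V" "vars \<Delta> \<subseteq> V"
  shows "\<exists>D. derivation (vars \<Delta>) \<Delta> S D \<and> concl D \<subseteq> S \<and> proof_size D \<le> 2 * card (V - var ` S) + 1"
  using assms(1,2)
proof (induction rule: up.induct)
  case (conflict C S)
  then show ?case by (intro exI[of _ "Leaf C"]) (auto simp: derivation_def)
next
  case (propagate C l S)
  show ?case
  proof (cases "C \<subseteq> S")
    case True
    then show ?thesis using propagate.hyps(1)
      by (intro exI[of _ "Leaf C"]) (auto simp: derivation_def)
  next
    case notsub: False
    then have l: "l \<in> C" "l \<notin> S" using propagate.hyps by auto
    show ?thesis
    proof (cases "neg l \<in> S")
      case True
      then show ?thesis using propagate by (simp add: insert_absorb)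
    next
      case False
      have nv: "var l \<notin> var ` S" using False l by (simp add: var_image_iff)
      have lV: "var l \<in> vars \<Delta>" using l propagate.hyps by (auto simp: vars_def)
      from nv have "consistent (insert (neg l) S)"
        by (intro consistent_insert propagate.prems) simp
      from propagate.IH[OF this] obtain D where D: "derivation (vars \<Delta>) \<Delta> (insert (neg l) S) D"
        "concl D \<subseteq> insert (neg l) S" "proof_size D \<le> 2 * card (V - var ` insert (neg l) S) + 1"
        by (elim exE conjE)
      have "V - var ` S = insert (var l) (V - var ` insert (neg l) S)"
        using lV nv assms(4) by auto
      then have "card (V - var ` S) = card (insert (var l) (V - var ` insert (neg l) S))"
        by (rule arg_cong)
      also have "\<dots> = Suc (card (V - var ` insert (neg l) S))"
        by (rule card_insert_disjoint) (use assms(3) in auto)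
      finally have "card (V - var ` S) = Suc (card (V - var ` insert (neg l) S))" .
      moreover have "derivation (vars \<Delta>) \<Delta> S (Resolve l (Leaf C) D)"
        using D propagate.hyps lV False l nv by (auto simp: derivation_def)
      moreover have "concl (Resolve l (Leaf C) D) \<subseteq> S" using D propagate.hyps by auto
      ultimately show ?thesis using D(3) by (intro exI[of _ "Resolve l (Leaf C) D"]) auto
    qed
  qed
qed

lemma w_resolution_resolved_vars: "w_resolution V D \<Longrightarrow> resolved_vars D \<subseteq> V"
  by (induction D) auto

lemma w_resolution_mono: "w_resolution V D \<Longrightarrow> V \<subseteq> W \<Longrightarrow> w_resolution W D"
  by (induction D) auto

section \<open>Available lemmas\<close>

text \<open>What a completed subtree contributes to the nodes after it in postorder, in a form fit
  for recursion; \<open>learned_eq\<close> relates it to positions.\<close>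

primrec learned :: "'v rtree \<Rightarrow> 'v clause set" where
  "learned (Leaf C) = {C}"
| "learned (Resolve x A B) = learned A \<union> learned B \<union>
     (if input_tree (Resolve x A B) then {concl (Resolve x A B)} else {})"

lemma concl_in_learned: "input_tree t \<Longrightarrow> concl t \<in> learned t"
  by (cases t) auto

lemma positions_simps [simp]:
  "positions (Leaf C) = {[]}"
  "positions (Resolve x A B) = Cons Lft ` positions A \<union> Cons Rgt ` positions B \<union> {[]}"
  by (auto simp: positions_def)

lemma learned_eq: "learned t = {concl (subtree t p) | p. p \<in> positions t \<and> input_tree (subtree t p)}"
proof (induction t)
  case (Leaf C)
  then show ?case by auto
next
  case (Resolve x A B)
  have "{concl (subtree (Resolve x A B) p) | p.
      p \<in> positions (Resolve x A B) \<and> input_tree (subtree (Resolve x A B) p)} =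
    {concl (subtree A p) | p. p \<in> positions A \<and> input_tree (subtree A p)} \<union>
    {concl (subtree B p) | p. p \<in> positions B \<and> input_tree (subtree B p)} \<union>
    (if input_tree (Resolve x A B) then {concl (Resolve x A B)} else {})"
    (is "?L = ?R")
  proof (intro equalityI subsetI)
    fix C assume "C \<in> ?L"
    then show "C \<in> ?R" by auto
  next
    fix C assume "C \<in> ?R"
    then consider p where "C = concl (subtree A p)" "p \<in> positions A" "input_tree (subtree A p)"
      | p where "C = concl (subtree B p)" "p \<in> positions B" "input_tree (subtree B p)"
      | "C = concl (Resolve x A B)" "input_tree (Resolve x A B)"
      by (auto split: if_splits)
    then show "C \<in> ?L"
    proof cases
      case 1
      then show ?thesis by (intro CollectI exI[of _ "Lft # p"]) auto
    next
      case 2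
      then show ?thesis by (intro CollectI exI[of _ "Rgt # p"]) auto
    next
      case 3
      then show ?thesis by (intro CollectI exI[of _ "[]"]) auto
    qed
  qed
  then show ?case using Resolve by simp
qed

lemma precedes_Lft: "precedes (Resolve x A B) p (Lft # q) \<longleftrightarrow> (\<exists>p'. p = Lft # p' \<and> precedes A p' q)"
proof
  assume "precedes (Resolve x A B) p (Lft # q)"
  then obtain i j where ij: "i < j" "j < length (postorder (Resolve x A B))"
    "postorder (Resolve x A B) ! i = p" "postorder (Resolve x A B) ! j = Lft # q"
    by (auto simp: precedes_def)
  have "j < length (postorder A)"
    using ij by (auto simp: nth_append nth_Cons' split: if_splits)
  then show "\<exists>p'. p = Lft # p' \<and> precedes A p' q"
    using ij by (intro exI[of _ "postorder A ! i"]) (auto simp: nth_append precedes_def)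
next
  assume "\<exists>p'. p = Lft # p' \<and> precedes A p' q"
  then obtain i j where "i < j" "j < length (postorder A)" "p = Lft # postorder A ! i" "postorder A ! j = q"
    by (auto simp: precedes_def)
  then show "precedes (Resolve x A B) p (Lft # q)"
    unfolding precedes_def by (intro exI[of _ i] exI[of _ j]) (auto simp: nth_append)
qed

lemma precedes_Rgt:
  assumes "q \<in> positions B"
  shows "precedes (Resolve x A B) p (Rgt # q) \<longleftrightarrow>
    (\<exists>p'\<in>positions A. p = Lft # p') \<or> (\<exists>p'. p = Rgt # p' \<and> precedes B p' q)"
proof
  let ?a = "length (postorder A)"
  assume "precedes (Resolve x A B) p (Rgt # q)"
  then obtain i j where ij: "i < j" "j < length (postorder (Resolve x A B))"
    "postorder (Resolve x A B) ! i = p" "postorder (Resolve x A B) ! j = Rgt # q"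
    by (auto simp: precedes_def)
  have j: "?a \<le> j" "j - ?a < length (postorder B)" "postorder B ! (j - ?a) = q"
    using ij by (auto simp: nth_append nth_Cons' split: if_splits)
  show "(\<exists>p'\<in>positions A. p = Lft # p') \<or> (\<exists>p'. p = Rgt # p' \<and> precedes B p' q)"
  proof (cases "i < ?a")
    case True
    then show ?thesis using ij by (auto simp: nth_append positions_def)
  next
    case False
    then have "i - ?a < j - ?a" "p = Rgt # postorder B ! (i - ?a)"
      using ij j by (auto simp: nth_append)
    then show ?thesis using j unfolding precedes_def by blast
  qed
next
  let ?a = "length (postorder A)"
  assume "(\<exists>p'\<in>positions A. p = Lft # p') \<or> (\<exists>p'. p = Rgt # p' \<and> precedes B p' q)"
  then show "precedes (Resolve x A B) p (Rgt # q)"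
  proof
    assume "\<exists>p'\<in>positions A. p = Lft # p'"
    then obtain i where "i < ?a" "p = Lft # postorder A ! i"
      by (auto simp: positions_def in_set_conv_nth)
    moreover obtain j where "j < length (postorder B)" "postorder B ! j = q"
      using assms by (auto simp: positions_def in_set_conv_nth)
    ultimately show ?thesis unfolding precedes_def
      by (intro exI[of _ i] exI[of _ "?a + j"]) (auto simp: nth_append)
  next
    assume "\<exists>p'. p = Rgt # p' \<and> precedes B p' q"
    then obtain i j where "i < j" "j < length (postorder B)" "p = Rgt # postorder B ! i" "postorder B ! j = q"
      by (auto simp: precedes_def)
    then show ?thesis unfolding precedes_def
      by (intro exI[of _ "?a + i"] exI[of _ "?a + j"]) (auto simp: nth_append)
  qed
qed

lemma available_Nil [simp]: "available \<Delta> R [] = \<Delta>"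
  by (auto simp: available_def)

lemma available_Lft: "available \<Delta> (Resolve x A B) (Lft # q) = available \<Delta> A q"
proof -
  have "{concl (subtree (Resolve x A B) p) | p. precedes (Resolve x A B) p (Lft # q) \<and>
      \<not> prefix (Lft # q) p \<and> input_tree (subtree (Resolve x A B) p)} =
    {concl (subtree A p) | p. precedes A p q \<and> \<not> prefix q p \<and> input_tree (subtree A p)}"
    unfolding precedes_Lft by force
  then show ?thesis by (simp add: available_def)
qed

text \<open>When the right subtree is begun, the left one is complete, so all its input
  subderivations are available there. The parent itself comes later in postorder and adds
  nothing.\<close>

lemma available_Rgt:
  assumes "q \<in> positions B"
  shows "available \<Delta> (Resolve x A B) (Rgt # q) = available (\<Delta> \<union> learned A) B q"
proof -
  have "{concl (subtree (Resolve x A B) p) | p. precedes (Resolve x A B) p (Rgt # q) \<and>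
      \<not> prefix (Rgt # q) p \<and> input_tree (subtree (Resolve x A B) p)} =
    learned A \<union> {concl (subtree B p) | p. precedes B p q \<and> \<not> prefix q p \<and> input_tree (subtree B p)}"
    (is "?L = ?R")
  proof (intro equalityI subsetI)
    fix C assume "C \<in> ?L"
    then show "C \<in> ?R" unfolding precedes_Rgt[OF assms] learned_eq by force
  next
    fix C assume "C \<in> ?R"
    then consider p where "C = concl (subtree A p)" "p \<in> positions A" "input_tree (subtree A p)"
      | p where "C = concl (subtree B p)" "precedes B p q" "\<not> prefix q p" "input_tree (subtree B p)"
      by (auto simp: learned_eq)
    then show "C \<in> ?L"
    proof cases
      case 1
      then show ?thesis unfolding precedes_Rgt[OF assms] by (intro CollectI exI[of _ "Lft # p"]) auto
    next
      case 2
      then show ?thesis unfolding precedes_Rgt[OF assms] by (intro CollectI exI[of _ "Rgt # p"]) auto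
    qed
  qed
  then show ?thesis by (auto simp: available_def)
qed

section \<open>A top-down invariant that implies greediness\<close>

text \<open>\<open>\<Delta>\<close> holds the clauses available when the subtree is begun and
  \<open>S\<close> the literals collected on the path, phantom ones included. Where propagation
  finds a conflict, the subtree must be an input derivation from \<open>\<Delta>\<close>; elsewhere
  one may branch on any unassigned variable.\<close>

primrec good :: "'v set \<Rightarrow> 'v rtree \<Rightarrow> 'v clause set \<Rightarrow> 'v lit set \<Rightarrow> bool" where
  "good V (Leaf C) \<Delta> S \<longleftrightarrow> C \<in> \<Delta> \<and> C \<subseteq> S"
| "good V (Resolve x A B) \<Delta> S \<longleftrightarrow> var x \<in> V \<and> var x \<notin> var ` S \<and>
     (up \<Delta> S \<longrightarrow> input_tree (Resolve x A B) \<and> leaves (Resolve x A B) \<subseteq> \<Delta>) \<and>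
     good V A \<Delta> (insert x S) \<and> good V B (\<Delta> \<union> learned A) (insert (neg x) S)"

lemma good_concl: "good V t \<Delta> S \<Longrightarrow> concl t \<subseteq> S"
proof (induction t arbitrary: \<Delta> S)
  case (Resolve x A B)
  have "concl A \<subseteq> insert x S" "concl B \<subseteq> insert (neg x) S"
    using Resolve.prems by (simp_all add: Resolve.IH(1)[of \<Delta>] Resolve.IH(2)[of "\<Delta> \<union> learned A"])
  then show ?case by auto
qed auto

lemma good_resolved_vars: "good V t \<Delta> S \<Longrightarrow> resolved_vars t \<inter> var ` S = {}"
proof (induction t arbitrary: \<Delta> S)
  case (Resolve x A B)
  have "resolved_vars A \<inter> var ` insert x S = {}" "resolved_vars B \<inter> var ` insert (neg x) S = {}"
    using Resolve.prems by (simp_all add: Resolve.IH(1)[of \<Delta>] Resolve.IH(2)[of "\<Delta> \<union> learned A"] del: image_insert)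
  with Resolve.prems show ?case by auto
qed auto

lemma good_regular: "good V t \<Delta> S \<Longrightarrow> regular t"
proof (induction t arbitrary: \<Delta> S)
  case (Resolve x A B)
  then have "resolved_vars A \<inter> var ` insert x S = {}" "resolved_vars B \<inter> var ` insert (neg x) S = {}"
    by (auto dest!: good_resolved_vars)
  with Resolve show ?case by auto
qed auto

lemma good_w_resolution: "good V t \<Delta> S \<Longrightarrow> w_resolution V t"
proof (induction t arbitrary: \<Delta> S)
  case (Resolve x A B)
  then have "concl A \<subseteq> insert x S" "concl B \<subseteq> insert (neg x) S" by (auto dest: good_concl)
  moreover have "x \<notin> S" "neg x \<notin> S" using Resolve.prems by (auto simp: var_image_iff)
  ultimately have "neg x \<notin> concl A" "x \<notin> concl B" by auto
  with Resolve show ?case by auto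
qed auto

lemma good_vars:
  "good V t \<Delta> S \<Longrightarrow> vars \<Delta> \<subseteq> V \<Longrightarrow> vars (learned t) \<subseteq> V \<and> var ` concl t \<subseteq> V"
proof (induction t arbitrary: \<Delta> S)
  case (Leaf C)
  then show ?case by (auto simp: vars_def)
next
  case (Resolve x A B)
  have A: "vars (learned A) \<subseteq> V" "var ` concl A \<subseteq> V"
    using Resolve.IH(1)[of \<Delta> "insert x S"] Resolve.prems by auto
  then have "vars (\<Delta> \<union> learned A) \<subseteq> V" using Resolve.prems by (auto simp: vars_def)
  then have B: "vars (learned B) \<subseteq> V" "var ` concl B \<subseteq> V" 
    using Resolve.IH(2)[of "\<Delta> \<union> learned A" "insert (neg x) S"] Resolve.prems by auto
  have "vars (learned (Resolve x A B)) \<subseteq> V" using A B by (auto simp: vars_def split: if_splits)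
  then show ?case using A B by auto
qed

text \<open>Every subtree of an input derivation is again one with leaves in
  \<open>\<Delta>\<close>, so the demand on conflicts is met at all nodes, whatever propagation
  finds there.\<close>

lemma good_derivation: "derivation V \<Delta> S D \<Longrightarrow> concl D \<subseteq> S \<Longrightarrow> good V D \<Delta> S"
proof (induction D arbitrary: \<Delta> S)
  case (Leaf C)
  then show ?case by (auto simp: derivation_def)
next
  case (Resolve x A B)
  have "derivation V \<Delta> (insert x S) A" "derivation V (\<Delta> \<union> learned A) (insert (neg x) S) B"
    using Resolve.prems by (auto simp: derivation_def)
  moreover have "concl A \<subseteq> insert x S" "concl B \<subseteq> insert (neg x) S" using Resolve.prems by auto
  ultimately have "good V A \<Delta> (insert x S)" "good V B (\<Delta> \<union> learned A) (insert (neg x) S)"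
    using Resolve.IH by blast+
  then show ?case using Resolve.prems by (auto simp: derivation_def)
qed

text \<open>The union with \<open>S\<close> carries the induction, since \<open>t\<close> may hang
  below a path on which \<open>S\<close> was collected. For a whole refutation \<open>S\<close> is
  empty and exactly \<open>path_lits\<close> remains.\<close>

lemma good_subtree:
  "good V t \<Delta> S \<Longrightarrow> q \<in> positions t \<Longrightarrow> good V (subtree t q) (available \<Delta> t q) (S \<union> path_lits t q)"
proof (induction t arbitrary: \<Delta> S q)
  case (Leaf C)
  then show ?case by auto
next
  case (Resolve x A B)
  note c = good_concl[OF Resolve.prems(1)]
  show ?case
  proof (cases q)
    case Nil
    then show ?thesis using Resolve.prems c by (simp add: Un_absorb2)
  next
    case (Cons d q')
    show ?thesis
    proof (cases d)
      case Lft
      then have q': "q' \<in> positions A" using Resolve.prems Cons by auto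
      have "S \<union> path_lits (Resolve x A B) q = insert x S \<union> path_lits A q'"
        using Cons Lft c by auto
      then show ?thesis
        using Resolve.IH(1)[of \<Delta> "insert x S" q'] Resolve.prems q' Cons Lft by (simp add: available_Lft)
    next
      case Rgt
      then have q': "q' \<in> positions B" using Resolve.prems Cons by auto
      have "S \<union> path_lits (Resolve x A B) q = insert (neg x) S \<union> path_lits B q'"
        using Cons Rgt c by auto
      then show ?thesis
        using Resolve.IH(2)[of "\<Delta> \<union> learned A" "insert (neg x) S" q'] Resolve.prems q' Cons Rgt
        by (simp add: available_Rgt)
    qed
  qed
qed

text \<open>By \<open>input_derivation_up\<close> the mere existence of a suitable input derivation
  at a node yields \<open>up\<close> there, and then the invariant forces the actual subtree to be
  an input derivation.\<close>

lemma good_imp_greedy_refutation: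
  assumes R: "good (vars \<Gamma>) R \<Gamma> {}"
  shows "regWRTI_refutation \<Gamma> R" "greedy_unit_propagating \<Gamma> R"
proof -
  have sub: "good (vars \<Gamma>) (subtree R q) (available \<Gamma> R q) (path_lits R q)" if "q \<in> positions R" for q
    using good_subtree[OF R that] by simp
  show "regWRTI_refutation \<Gamma> R"
    unfolding regWRTI_refutation_def regWRTI_def
  proof (intro conjI ballI allI impI)
    fix q C assume "q \<in> positions R" "subtree R q = Leaf C"
    then have "C \<in> available \<Gamma> R q" using sub[of q] by simp
    then show "C \<in> \<Gamma> \<or> lemma_at R q C" by (auto simp: available_def lemma_at_def)
  qed (use R good_w_resolution good_regular good_concl in blast)+
  show "greedy_unit_propagating \<Gamma> R"
    unfolding greedy_unit_propagating_def
  proof (intro ballI impI)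
    fix q
    let ?\<Delta> = "available \<Gamma> R q" and ?S = "path_lits R q"
    assume q: "q \<in> positions R" and "\<exists>D. input_derivation_from ?\<Delta> D \<and> concl D \<subseteq> ?S \<and> resolves_on_none_of ?S D"
    then have "up ?\<Delta> ?S" by (auto simp: input_derivation_from_def intro: input_derivation_up)
    then have "input_tree (subtree R q) \<and> leaves (subtree R q) \<subseteq> ?\<Delta>"
      using sub[OF q] by (cases "subtree R q") auto
    moreover have "w_resolution (vars ?\<Delta>) (subtree R q)"
      by (rule w_resolution_mono[OF good_w_resolution[OF sub[OF q]]]) (auto simp: vars_def available_def)
    ultimately show "input_derivation_from ?\<Delta> (subtree R q) \<and> resolves_on_none_of ?S (subtree R q)"
      using good_resolved_vars[OF sub[OF q]] by (simp add: input_derivation_from_def resolves_on_none_of_def)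
  qed
qed

text \<open>Phantom literals make it possible to learn any clause that has an input derivation off the
  current path: its remaining literals are removed by resolving with a falsified clause \<open>C\<close>.\<close>

lemma phantom_derivation:
  assumes "derivation V \<Delta> S D" "finite (concl D)" "consistent (concl D)" "var ` concl D \<subseteq> V"
    "\<And>l. l \<in> concl D \<Longrightarrow> neg l \<notin> S" "resolved_vars D \<inter> var ` concl D = {}"
    "C \<in> \<Delta>" "C \<subseteq> S" "finite C" "consistent S" "var ` C \<subseteq> V"
  shows "\<exists>D'. derivation V \<Delta> S D' \<and> concl D' \<subseteq> S \<and> learned D \<subseteq> learned D' \<and>
    proof_size D' = proof_size D + 2 * card (concl D - S)"
  using assms
proof (induction "card (concl D - S)" arbitrary: D)
  case 0
  then have "concl D \<subseteq> S" by auto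
  then show ?case using 0 by (intro exI[of _ D]) auto
next
  case (Suc m)
  then have "concl D - S \<noteq> {}" by force
  then obtain l where l: "l \<in> concl D" "l \<notin> S" by auto
  have nl: "neg l \<notin> S" "neg l \<notin> concl D" using l Suc.prems by (auto simp: consistent_def)
  then have vl: "var l \<notin> var ` S" using l by (simp add: var_image_iff)
  \<comment> \<open>\<open>neg l\<close> is a phantom literal of \<open>C\<close>. The inference
    deletes \<open>l\<close> and brings in only falsified literals, so one literal fewer lies
    outside \<open>S\<close>.\<close>
  let ?D = "Resolve l D (Leaf C)"
  have c: "concl ?D = (concl D - {l}) \<union> C" using nl Suc.prems(8) by auto
  have CS: "neg k \<notin> S" if "k \<in> C" for k using that Suc.prems by (auto simp: consistent_def)
  have m: "concl ?D - S = (concl D - S) - {l}" unfolding c using Suc.prems(8) by auto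
  then have card: "card (concl D - S) = Suc (card (concl ?D - S))"
    using l Suc.prems(2) by (metis DiffI card.remove finite_Diff)
  have vC: "var ` C \<subseteq> var ` S" using Suc.prems(8) by auto
  have "var l \<notin> resolved_vars D" using Suc.prems(6) l by auto
  then have "derivation V \<Delta> S ?D"
    using Suc.prems l nl vl by (auto simp: derivation_def)
  moreover have "consistent (concl ?D)"
    unfolding c consistent_def
  proof (intro ballI notI)
    fix k assume k: "k \<in> concl D - {l} \<union> C" "neg k \<in> concl D - {l} \<union> C"
    show False
    proof (cases "k \<in> C")
      case True
      then have "k \<in> S" "neg k \<notin> C" using Suc.prems(8) CS[of k] by auto
      then show False using k(2) Suc.prems(5)[of "neg k"] by auto
    next
      case False
      then have "k \<in> concl D" using k by auto
      then have "neg k \<notin> C" "neg k \<notin> concl D"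
        using Suc.prems(3,5,8) by (auto simp: consistent_def)
      then show False using k(2) by auto
    qed
  qed
  moreover have "resolved_vars ?D \<inter> var ` concl ?D = {}"
  proof -
    have "resolved_vars D \<inter> var ` S = {}" using Suc.prems(1) by (simp add: derivation_def)
    moreover have "var l \<notin> var ` (concl D - {l})" using nl by (auto simp: var_eq_iff)
    moreover have "var l \<notin> var ` C" "resolved_vars D \<inter> var ` C = {}" using vC vl calculation(1) by auto
    ultimately show ?thesis unfolding c using Suc.prems(6) by auto
  qed
  moreover have "neg k \<notin> S" if "k \<in> concl ?D" for k
    using that CS Suc.prems(5) unfolding c by auto
  moreover have "finite (concl ?D)" "var ` concl ?D \<subseteq> V"
    unfolding c using Suc.prems(2,4,9,11) by auto
  moreover have "m = card (concl ?D - S)" using card Suc.hyps(2) by simp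
  ultimately obtain D' where D': "derivation V \<Delta> S D'" "concl D' \<subseteq> S" "learned ?D \<subseteq> learned D'"
      "proof_size D' = proof_size ?D + 2 * card (concl ?D - S)"
    using Suc.hyps(1)[of ?D] Suc.prems(7-) by blast
  then show ?case using card by (intro exI[of _ D']) auto
qed

section \<open>Amortized search\<close>

locale clause_set =
  fixes \<Gamma> :: "'v clause set"
  assumes finite_vars: "finite (vars \<Gamma>)"
begin

text \<open>Learned clauses bring no new variables, so one bound on input derivations serves for all
  clause sets met during the search.\<close>

definition extends :: "'v clause set \<Rightarrow> bool" where
  "extends \<Delta> \<longleftrightarrow> \<Gamma> \<subseteq> \<Delta> \<and> vars \<Delta> \<subseteq> vars \<Gamma>"

lemma extends_vars: "extends \<Delta> \<Longrightarrow> vars \<Delta> = vars \<Gamma>"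
  by (auto simp: extends_def vars_def)

abbreviation refutes :: "'v clause set \<Rightarrow> 'v lit set \<Rightarrow> 'v rtree \<Rightarrow> bool" where
  "refutes \<Delta> S t \<equiv> good (vars \<Gamma>) t \<Delta> S"

text \<open>The size of an input derivation that resolves on every variable once: as many inferences
  as variables, and one leaf more.\<close>

definition leaf_bound :: nat where
  "leaf_bound = 2 * card (vars \<Gamma>) + 1"

lemma extends_learned: "extends \<Delta> \<Longrightarrow> refutes \<Delta> S t \<Longrightarrow> extends (\<Delta> \<union> learned t)"
  using good_vars[of "vars \<Gamma>" t \<Delta> S] by (auto simp: extends_def vars_def)

lemma refutes_up:
  assumes "up \<Delta> S" "consistent S" "extends \<Delta>"
  obtains t where "refutes \<Delta> S t" "proof_size t \<le> leaf_bound"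
proof -
  obtain D where D: "derivation (vars \<Delta>) \<Delta> S D" "concl D \<subseteq> S"
    "proof_size D \<le> 2 * card (vars \<Gamma> - var ` S) + 1"
    using up_derivation[OF assms(1,2) finite_vars] assms(3) by (auto simp: extends_def)
  moreover have "card (vars \<Gamma> - var ` S) \<le> card (vars \<Gamma>)"
    using finite_vars by (intro card_mono) auto
  ultimately show ?thesis
    using that[of D] extends_vars[OF assms(3)] by (auto simp: leaf_bound_def intro: good_derivation)
qed

text \<open>Closability survives the learning of further clauses.\<close>

definition closable :: "'v clause set \<Rightarrow> 'v lit set \<Rightarrow> nat \<Rightarrow> bool" where
  "closable \<Delta> S N \<longleftrightarrow> (consistent S \<longrightarrow>
     (\<forall>\<Delta>'. \<Delta> \<subseteq> \<Delta>' \<longrightarrow> extends \<Delta>' \<longrightarrow> (\<exists>t. refutes \<Delta>' S t \<and> proof_size t \<le> N)))"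

lemma closableD:
  assumes "closable \<Delta> S N" "consistent S" "\<Delta> \<subseteq> \<Delta>'" "extends \<Delta>'"
  obtains t where "refutes \<Delta>' S t" "proof_size t \<le> N"
  using assms by (auto simp: closable_def)

lemma closable_mono: "closable \<Delta> S M \<Longrightarrow> M \<le> N \<Longrightarrow> closable \<Delta> S N"
  unfolding closable_def by (meson le_trans)

lemma closable_up: "up \<Delta> S \<Longrightarrow> closable \<Delta> S leaf_bound"
  unfolding closable_def by (meson refutes_up up_mono order_refl)

text \<open>Two situations deviate from plain branching. If the variable is already assigned, one of
  the children coincides with \<open>S\<close>. If the available lemmas make \<open>S\<close>
  propagate to a conflict, the greedy rule calls for an input derivation instead, and
  \<open>leaf_bound \<le> M\<close> pays for it.\<close>

lemma closable_branch:
  assumes "var x \<in> vars \<Gamma>" "closable \<Delta> (insert x S) M" "closable \<Delta> (insert (neg x) S) N"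
    and "leaf_bound \<le> M"
  shows "closable \<Delta> S (Suc (M + N))"
proof (cases "var x \<in> var ` S")
  case True
  then have "insert x S = S \<or> insert (neg x) S = S" by (auto simp: var_image_iff)
  then show ?thesis using assms closable_mono[of \<Delta> S _ "Suc (M + N)"] by auto
next
  case False
  show ?thesis unfolding closable_def
  proof (intro impI allI)
    fix \<Delta>' assume S: "consistent S" and \<Delta>': "\<Delta> \<subseteq> \<Delta>'" "extends \<Delta>'"
    show "\<exists>t. refutes \<Delta>' S t \<and> proof_size t \<le> Suc (M + N)"
    proof (cases "up \<Delta>' S")
      case True
      then obtain t where "refutes \<Delta>' S t" "proof_size t \<le> leaf_bound"
        using refutes_up S \<Delta>' by blast
      then show ?thesis using assms(4) by (intro exI[of _ t]) auto
    next
      case nup: False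
      have c: "consistent (insert x S)" "consistent (insert (neg x) S)"
        using S False by (auto intro: consistent_insert)
      obtain A where A: "refutes \<Delta>' (insert x S) A" "proof_size A \<le> M"
        using closableD[OF assms(2) c(1) \<Delta>'] .
      obtain B where B: "refutes (\<Delta>' \<union> learned A) (insert (neg x) S) B" "proof_size B \<le> N"
        using closableD[OF assms(3) c(2) _ extends_learned[OF \<Delta>'(2) A(1)]] \<Delta>'(1) by blast
      show ?thesis using A B nup False assms(1) by (intro exI[of _ "Resolve x A B"]) auto
    qed
  qed
qed

section \<open>Size bounds by a potential\<close>

text \<open>\<open>\<phi>\<close> is to count the wanted clauses that are still missing. Each one
  learned inside \<open>t\<close> buys three further units of size \<open>Q\<close>, one for each
  branch that is left open in \<open>amortized_branch3\<close>.\<close>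

definition amortized :: "('v clause set \<Rightarrow> nat) \<Rightarrow> nat \<Rightarrow> 'v clause set \<Rightarrow> 'v lit set \<Rightarrow> bool" where
  "amortized \<phi> Q \<Delta> S \<longleftrightarrow>
     (\<exists>t. refutes \<Delta> S t \<and> proof_size t \<le> Q * (1 + 3 * (\<phi> \<Delta> - \<phi> (\<Delta> \<union> learned t))))"

lemma amortizedI: "refutes \<Delta> S t \<Longrightarrow> proof_size t \<le> Q \<Longrightarrow> amortized \<phi> Q \<Delta> S"
  unfolding amortized_def by (rule exI[of _ t]) (auto intro: le_trans)

lemma amortized_up:
  "up \<Delta> S \<Longrightarrow> consistent S \<Longrightarrow> extends \<Delta> \<Longrightarrow> leaf_bound \<le> Q \<Longrightarrow> amortized \<phi> Q \<Delta> S"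
  by (meson amortizedI le_trans refutes_up)

text \<open>The tree is a comb with decisions \<open>x\<close>, \<open>y\<close>, \<open>z\<close>.
  Its tip \<open>t0\<close> comes first in postorder and learns a wanted clause. The tip and the
  three inferences fit into one unit \<open>Q\<close>; the three open branches need one unit each
  beyond what their own learning pays for, and the drop of \<open>\<phi>\<close> at the tip covers
  these.\<close>

lemma amortized_branch3:
  assumes \<phi>: "antimono \<phi>" and \<Delta>: "extends \<Delta>"
    and nup: "\<not> up \<Delta> (insert y (insert x S))"
    and x: "var x \<in> vars \<Gamma>" "var x \<notin> var ` S"
    and y: "var y \<in> vars \<Gamma>" "var y \<notin> var ` insert x S"
    and z: "var z \<in> vars \<Gamma>" "var z \<notin> var ` insert y (insert x S)"
    and t0: "refutes \<Delta> (insert z (insert y (insert x S))) t0" "proof_size t0 + 3 \<le> Q"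
      "\<phi> (\<Delta> \<union> learned t0) < \<phi> \<Delta>"
    and open1: "\<And>\<Delta>'. \<Delta> \<subseteq> \<Delta>' \<Longrightarrow> extends \<Delta>' \<Longrightarrow> amortized \<phi> Q \<Delta>' (insert (neg z) (insert y (insert x S)))"
    and open2: "\<And>\<Delta>'. \<Delta> \<subseteq> \<Delta>' \<Longrightarrow> extends \<Delta>' \<Longrightarrow> amortized \<phi> Q \<Delta>' (insert (neg y) (insert x S))"
    and open3: "\<And>\<Delta>'. \<Delta> \<subseteq> \<Delta>' \<Longrightarrow> extends \<Delta>' \<Longrightarrow> amortized \<phi> Q \<Delta>' (insert (neg x) S)"
  shows "amortized \<phi> Q \<Delta> S"
proof -
  \<comment> \<open>Propagation is monotone in the falsified set, so the absence of a conflict at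
    the deepest branching node extends to all branching nodes of the comb.\<close>
  have nups: "\<not> up \<Delta> (insert x S)" "\<not> up \<Delta> S"
    using nup by (auto dest: up_mono[where \<Delta>' = \<Delta> and S' = "insert y (insert x S)"])
  let ?\<Delta>1 = "\<Delta> \<union> learned t0"
  have e1: "extends ?\<Delta>1" using extends_learned[OF \<Delta> t0(1)] .
  then obtain t1 where t1: "refutes ?\<Delta>1 (insert (neg z) (insert y (insert x S))) t1"
    "proof_size t1 \<le> Q * (1 + 3 * (\<phi> ?\<Delta>1 - \<phi> (?\<Delta>1 \<union> learned t1)))"
    using open1[of ?\<Delta>1] by (auto simp: amortized_def)
  let ?b = "Resolve z t0 t1" let ?\<Delta>2 = "\<Delta> \<union> learned ?b"
  have b: "refutes \<Delta> (insert y (insert x S)) ?b" using t0 t1 nup z by simp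
  have e2: "extends ?\<Delta>2" using extends_learned[OF \<Delta> b] .
  then obtain t2 where t2: "refutes ?\<Delta>2 (insert (neg y) (insert x S)) t2"
    "proof_size t2 \<le> Q * (1 + 3 * (\<phi> ?\<Delta>2 - \<phi> (?\<Delta>2 \<union> learned t2)))"
    using open2[of ?\<Delta>2] unfolding amortized_def by blast
  let ?c = "Resolve y ?b t2" let ?\<Delta>3 = "\<Delta> \<union> learned ?c"
  have c: "refutes \<Delta> (insert x S) ?c" using b t2 nups(1) y
    unfolding good.simps(2)[of _ y] by blast
  have e3: "extends ?\<Delta>3" using extends_learned[OF \<Delta> c] .
  then obtain t3 where t3: "refutes ?\<Delta>3 (insert (neg x) S) t3"
    "proof_size t3 \<le> Q * (1 + 3 * (\<phi> ?\<Delta>3 - \<phi> (?\<Delta>3 \<union> learned t3)))"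
    using open3[of ?\<Delta>3] unfolding amortized_def by blast
  let ?t = "Resolve x ?c t3"
  have t: "refutes \<Delta> S ?t" using c t3 nups(2) x
    unfolding good.simps(2)[of _ x] by blast
  \<comment> \<open>What one branch learns is available in the next, so the drops of
    \<open>\<phi>\<close> in the branches do not overlap and their sum telescopes.\<close>
  have chain: "\<phi> (?\<Delta>1 \<union> learned t1) \<le> \<phi> ?\<Delta>1" "\<phi> ?\<Delta>2 \<le> \<phi> (?\<Delta>1 \<union> learned t1)"
    "\<phi> (?\<Delta>2 \<union> learned t2) \<le> \<phi> ?\<Delta>2" "\<phi> ?\<Delta>3 \<le> \<phi> (?\<Delta>2 \<union> learned t2)"
    "\<phi> (?\<Delta>3 \<union> learned t3) \<le> \<phi> ?\<Delta>3" "\<phi> (\<Delta> \<union> learned ?t) \<le> \<phi> (?\<Delta>3 \<union> learned t3)"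
    by (rule antimonoD[OF \<phi>], force)+
  let ?d = "(\<phi> ?\<Delta>1 - \<phi> (?\<Delta>1 \<union> learned t1)) + (\<phi> ?\<Delta>2 - \<phi> (?\<Delta>2 \<union> learned t2)) +
    (\<phi> ?\<Delta>3 - \<phi> (?\<Delta>3 \<union> learned t3))"
  have d: "1 + ?d \<le> \<phi> \<Delta> - \<phi> (\<Delta> \<union> learned ?t)" using chain t0(3) by linarith
  have "proof_size ?t = 3 + proof_size t0 + proof_size t1 + proof_size t2 + proof_size t3" by simp
  also have "\<dots> \<le> Q + Q * (1 + 3 * (\<phi> ?\<Delta>1 - \<phi> (?\<Delta>1 \<union> learned t1))) +
    Q * (1 + 3 * (\<phi> ?\<Delta>2 - \<phi> (?\<Delta>2 \<union> learned t2))) +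
    Q * (1 + 3 * (\<phi> ?\<Delta>3 - \<phi> (?\<Delta>3 \<union> learned t3)))"
    using t0(2) t1(2) t2(2) t3(2) by linarith
  also have "\<dots> = Q * (1 + 3 * (1 + ?d))" by (simp add: algebra_simps)
  also have "\<dots> \<le> Q * (1 + 3 * (\<phi> \<Delta> - \<phi> (\<Delta> \<union> learned ?t)))"
    by (intro mult_le_mono add_le_mono d order_refl)
  finally show ?thesis using t unfolding amortized_def by blast
qed

end

section \<open>Guarded graph tautologies\<close>

lemma xlit_eq_iff: "a \<noteq> b \<Longrightarrow> c \<noteq> d \<Longrightarrow> xlit a b = xlit c d \<longleftrightarrow> a = c \<and> b = d"
  by (auto simp: xlit_def)

lemma var_xlit_eq_iff:
  "a \<noteq> b \<Longrightarrow> c \<noteq> d \<Longrightarrow> var (xlit a b) = var (xlit c d) \<longleftrightarrow> a = c \<and> b = d \<or> a = d \<and> b = c"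
  by (auto simp: xlit_def)

lemma T_eq: "distinct [i, j, k] \<Longrightarrow> T i j k = {xlit j i, xlit k j, xlit i k}"
  by (auto simp: T_def neg_xlit)

lemma predecessor_clause_mem: "i < n \<Longrightarrow> {xlit j i | j. j < n \<and> j \<noteq> i} \<in> GGT n r s"
  unfolding GGT_def by blast

lemma guard_clause_mem:
  assumes "distinct_triple n i j k"
  shows "insert (xlit (r i j k) (s i j k)) (T i j k) \<in> GGT n r s"
    "insert (neg (xlit (r i j k) (s i j k))) (T i j k) \<in> GGT n r s"
  using assms unfolding GGT_def insert_is_Un[of _ "T i j k"] Un_commute[of _ "T i j k"] by blast+

lemma vars_GGT:
  assumes "guards n r s"
  shows "vars (GGT n r s) = {var (xlit a b) | a b. a < n \<and> b < n \<and> a \<noteq> b}"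
proof (intro equalityI subsetI)
  fix v assume "v \<in> vars (GGT n r s)"
  then obtain C l where C: "C \<in> GGT n r s" "l \<in> C" "v = var l" by (auto simp: vars_def)
  have "\<exists>a b. var l = var (xlit a b) \<and> a < n \<and> b < n \<and> a \<noteq> b"
  proof -
    from C(1) consider i where "C = {xlit j i | j. j < n \<and> j \<noteq> i}" "i < n"
      | i j k g where "C = T i j k \<union> {g}" "distinct_triple n i j k"
        "var g = var (xlit (r i j k) (s i j k))"
      unfolding GGT_def by force
    then show ?thesis
    proof cases
      case 1
      then show ?thesis using C(2) by auto
    next
      case 2
      then have d: "i < n" "j < n" "k < n" "distinct [i, j, k]" by (auto simp: distinct_triple_def)
      have g: "r i j k < n" "s i j k < n" "r i j k \<noteq> s i j k"
        using assms 2(2) d unfolding guards_def by auto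
      from C(2) 2 consider "l = xlit j i" | "l = xlit k j" | "l = xlit i k" | "l = g"
        using T_eq[OF d(4)] by auto
      then show ?thesis
      proof cases
        case 1 then show ?thesis using d by auto
      next
        case 2 then show ?thesis using d by auto
      next
        case 3 then show ?thesis using d by auto
      next
        case 4 then show ?thesis using g \<open>var g = _\<close> by auto
      qed
    qed
  qed
  then show "v \<in> {var (xlit a b) | a b. a < n \<and> b < n \<and> a \<noteq> b}" using C(3) by auto
next
  fix v assume "v \<in> {var (xlit a b) | a b. a < n \<and> b < n \<and> a \<noteq> b}"
  then obtain a b where "v = var (xlit a b)" "a < n" "b < n" "a \<noteq> b" by auto
  then show "v \<in> vars (GGT n r s)"
    unfolding vars_def by (intro UN_I[OF predecessor_clause_mem[of b]]) auto
qed

lemma vars_GGT_subset: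
  assumes "guards n r s"
  shows "vars (GGT n r s) \<subseteq> {..<n} \<times> {..<n}"
  unfolding vars_GGT[OF assms] by (auto simp: xlit_def)

lemma three_elements:
  assumes "finite A" "3 \<le> card A"
  obtains u v w where "u \<in> A" "v \<in> A" "w \<in> A" "distinct [u, v, w]"
proof -
  obtain B where B: "B \<subseteq> A" "card B = 3" using assms by (meson obtain_subset_with_card_n)
  then obtain u v w where "B = {u, v, w}" "u \<noteq> v" "v \<noteq> w" "u \<noteq> w"
    by (auto simp: card_3_iff)
  then show ?thesis using that[of u v w] B by auto
qed

locale guarded =
  fixes n :: nat and r s :: "nat \<Rightarrow> nat \<Rightarrow> nat \<Rightarrow> nat"
  assumes guards: "guards n r s"
begin

sublocale clause_set "GGT n r s"
  by standard (rule finite_subset[OF vars_GGT_subset[OF guards]], simp)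

lemma card_vars: "card (vars (GGT n r s)) \<le> n * n"
  using card_mono[OF _ vars_GGT_subset[OF guards]] by simp

lemma var_xlit_mem: "a < n \<Longrightarrow> b < n \<Longrightarrow> a \<noteq> b \<Longrightarrow> var (xlit a b) \<in> vars (GGT n r s)"
  unfolding vars_GGT[OF guards] by auto

text \<open>Under a falsified triangle one guard clause is unit in the guard, and the other is then
  falsified. Hence every 3-cycle is a conflict.\<close>

lemma up_cycle:
  assumes "distinct_triple n i j k" "T i j k \<subseteq> S" "GGT n r s \<subseteq> \<Delta>"
  shows "up \<Delta> S"
proof (rule up.propagate)
  let ?g = "xlit (r i j k) (s i j k)"
  show "insert ?g (T i j k) \<in> \<Delta>" using guard_clause_mem(1)[OF assms(1)] assms(3) by blast
  show "insert ?g (T i j k) \<subseteq> insert ?g S" using assms(2) by blast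
  show "up \<Delta> (insert (neg ?g) S)"
  proof (rule up.conflict)
    show "insert (neg ?g) (T i j k) \<in> \<Delta>" using guard_clause_mem(2)[OF assms(1)] assms(3) by blast
  qed (use assms(2) in blast)
qed

text \<open>A vertex \<open>u\<close> has been decided to precede \<open>v\<close> iff \<open>xlit v u\<close> is in the set \<open>S\<close> of falsified literals.\<close>

definition edges :: "(nat \<times> nat) lit set \<Rightarrow> (nat \<times> nat) set" where
  "edges S = {(u, v). u \<noteq> v \<and> xlit v u \<in> S}"

lemma edges_mono: "S \<subseteq> S' \<Longrightarrow> (edges S)\<^sup>* \<subseteq> (edges S')\<^sup>*"
  by (intro rtrancl_mono) (auto simp: edges_def)

section \<open>Closing a branch by finding the minimum of the pool\<close>

text \<open>The clause says that \<open>m\<close> is not the minimum of the first \<open>k\<close>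
  vertices, weakened by literals of \<open>S\<close>. For \<open>k = n\<close> it is an
  axiom.\<close>

definition available_min :: "(nat \<times> nat) clause set \<Rightarrow> (nat \<times> nat) lit set \<Rightarrow> nat \<Rightarrow> nat \<Rightarrow> bool" where
  "available_min \<Delta> S k m \<longleftrightarrow> (\<exists>C\<in>\<Delta>. C \<subseteq> S \<union> {xlit j m | j. j < k \<and> j \<noteq> m})"

lemma available_min_mono:
  "available_min \<Delta> S k m \<Longrightarrow> \<Delta> \<subseteq> \<Delta>' \<Longrightarrow> S \<subseteq> S' \<Longrightarrow> available_min \<Delta>' S' k m"
  unfolding available_min_def by blast

lemma available_min_n: "GGT n r s \<subseteq> \<Delta> \<Longrightarrow> m < n \<Longrightarrow> available_min \<Delta> S n m"
  unfolding available_min_def using predecessor_clause_mem[of m n r s] by blast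

definition literals_below :: "nat \<Rightarrow> (nat \<times> nat) lit set" where
  "literals_below k = {xlit a b | a b. a < k \<and> b < k \<and> a \<noteq> b}"

lemma xlit_below: "a < k \<Longrightarrow> b < k \<Longrightarrow> a \<noteq> b \<Longrightarrow> xlit a b \<in> literals_below k"
  by (auto simp: literals_below_def)

lemma xlit_belowD: "xlit a b \<in> literals_below k \<Longrightarrow> a \<noteq> b \<Longrightarrow> a < k \<and> b < k"
  by (auto simp: literals_below_def xlit_eq_iff)

definition root_bound :: nat where
  "root_bound = leaf_bound + n * Suc leaf_bound"

text \<open>\<open>\<rho>\<close> precedes every vertex, though perhaps only along paths. Each
  decision replaces a path of two edges from \<open>\<rho>\<close> by a direct edge; the opposite
  answer closes a 3-cycle and is a conflict. When all edges are direct, the minimum clause of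
  \<open>\<rho>\<close> is falsified.\<close>

lemma closable_root:
  assumes "GGT n r s \<subseteq> \<Delta>" "k \<le> n" "\<rho> < k" "S \<subseteq> literals_below k"
    "\<And>v. v < k \<Longrightarrow> (\<rho>, v) \<in> (edges S)\<^sup>*" "available_min \<Delta> S k \<rho>"
  shows "closable \<Delta> S (leaf_bound + card {v. v < k \<and> v \<noteq> \<rho> \<and> xlit v \<rho> \<notin> S} * Suc leaf_bound)"
  using assms(4-)
proof (induction "card {v. v < k \<and> v \<noteq> \<rho> \<and> xlit v \<rho> \<notin> S}" arbitrary: S)
  case 0
  then have "{xlit j \<rho> | j. j < k \<and> j \<noteq> \<rho>} \<subseteq> S" by auto
  then have "up \<Delta> S" using 0(4) unfolding available_min_def by (meson Un_subset_iff order_refl subset_trans up.conflict Un_least)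
  then show ?case unfolding 0(1)[symmetric] by (simp add: closable_up)
next
  case (Suc m)
  let ?X = "\<lambda>S. {v. v < k \<and> v \<noteq> \<rho> \<and> xlit v \<rho> \<notin> S}"
  have fin: "finite (?X S)" by simp
  \<comment> \<open>Otherwise the direct successors of \<open>\<rho>\<close> would be closed under
    edges and thus contain every vertex reachable from it, leaving nothing to decide.\<close>
  have "\<exists>u v. u \<noteq> \<rho> \<and> xlit u \<rho> \<in> S \<and> (u, v) \<in> edges S \<and> v \<noteq> \<rho> \<and> xlit v \<rho> \<notin> S"
  proof (rule ccontr)
    assume no: "\<not> ?thesis"
    have "v = \<rho> \<or> xlit v \<rho> \<in> S" if "(\<rho>, v) \<in> (edges S)\<^sup>*" for v
      using that
    proof (induction rule: rtrancl_induct)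
      case (step u v)
      then show ?case using no by (cases "u = \<rho>") (auto simp: edges_def)
    qed simp
    then have "?X S = {}" using Suc.prems(2) by auto
    then have "Suc m = 0" using Suc.hyps(2) by (simp only: card.empty)
    then show False by simp
  qed
  then obtain u v where uv: "u \<noteq> \<rho>" "xlit u \<rho> \<in> S" "(u, v) \<in> edges S" "v \<noteq> \<rho>" "xlit v \<rho> \<notin> S" by blast
  then have uv': "u \<noteq> v" "xlit v u \<in> S" by (auto simp: edges_def)
  have lt: "u < k" "v < k" using xlit_belowD uv uv' Suc.prems(1) by blast+
  have dt: "distinct_triple n \<rho> u v" using lt assms(2,3) uv uv' by (auto simp: distinct_triple_def)
  have "T \<rho> u v \<subseteq> insert (xlit \<rho> v) S"
    using uv uv' by (simp add: T_eq)
  then have left: "closable \<Delta> (insert (xlit \<rho> v) S) leaf_bound"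
    by (intro closable_up up_cycle[OF dt] assms(1))
  let ?S = "insert (xlit v \<rho>) S"
  have X: "?X ?S = ?X S - {v}" using uv by (auto simp: xlit_eq_iff)
  have m: "m = card (?X ?S)" using Suc.hyps(2) lt uv unfolding X by simp
  have "closable \<Delta> ?S (leaf_bound + card (?X ?S) * Suc leaf_bound)"
  proof (rule Suc.hyps(1)[OF m])
    show "?S \<subseteq> literals_below k" using Suc.prems(1) lt assms(3) uv by (auto intro: xlit_below)
    show "(\<rho>, w) \<in> (edges ?S)\<^sup>*" if "w < k" for w
      using Suc.prems(2)[OF that] edges_mono[of S ?S] by blast
    show "available_min \<Delta> ?S k \<rho>" using Suc.prems(3) by (rule available_min_mono) auto
  qed
  then have right: "closable \<Delta> (insert (neg (xlit \<rho> v)) S) (leaf_bound + m * Suc leaf_bound)"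
    using uv m by (simp add: neg_xlit)
  have "var (xlit \<rho> v) \<in> vars (GGT n r s)" using lt assms(2,3) uv by (intro var_xlit_mem) auto
  from closable_branch[OF this left right] Suc.hyps(2)[symmetric] show ?case by (simp add: algebra_simps)
qed

lemma closable_pool:
  assumes "GGT n r s \<subseteq> \<Delta>" "k \<le> n" "finite U" "U \<noteq> {}" "U \<subseteq> {..<k}" "S \<subseteq> literals_below k"
    "\<And>v. v < k \<Longrightarrow> \<exists>u\<in>U. (u, v) \<in> (edges S)\<^sup>*" "\<And>u. u \<in> U \<Longrightarrow> available_min \<Delta> S k u"
  shows "closable \<Delta> S (2 ^ card U * Suc root_bound - 1)"
  using assms(3-)
proof (induction "card U" arbitrary: U S)
  case 0
  then show ?case by simp
next
  case (Suc m)
  show ?case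
  proof (cases "\<exists>u. U = {u}")
    case True
    then obtain u where u: "U = {u}" by blast
    have "closable \<Delta> S (leaf_bound + card {v. v < k \<and> v \<noteq> u \<and> xlit v u \<notin> S} * Suc leaf_bound)"
      using Suc.prems u by (intro closable_root[OF assms(1,2)]) auto
    moreover have "card {v. v < k \<and> v \<noteq> u \<and> xlit v u \<notin> S} \<le> card {..<n}"
      using assms(2) by (intro card_mono) auto
    then have "leaf_bound + card {v. v < k \<and> v \<noteq> u \<and> xlit v u \<notin> S} * Suc leaf_bound \<le> root_bound"
      unfolding root_bound_def by (intro add_left_mono mult_le_mono1) simp
    ultimately show ?thesis by (rule closable_mono[OF closable_mono]) (simp add: u)
  next
    case False
    then obtain u w where uw: "u \<in> U" "w \<in> U" "u \<noteq> w" using Suc.prems(2) by blast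
    have less: "closable \<Delta> (insert (xlit b a) S) (2 ^ m * Suc root_bound - 1)"
      if ab: "a \<in> U" "b \<in> U" "a \<noteq> b" for a b
    proof -
      let ?S = "insert (xlit b a) S"
      have e: "(a, b) \<in> edges ?S" using ab by (auto simp: edges_def)
      have "m = card (U - {b})" using Suc.hyps(2) Suc.prems(1) ab by simp
      moreover have "\<exists>u\<in>U - {b}. (u, v) \<in> (edges ?S)\<^sup>*" if v: "v < k" for v
      proof -
        obtain u where u: "u \<in> U" "(u, v) \<in> (edges ?S)\<^sup>*"
          using Suc.prems(5)[OF v] edges_mono[of S ?S] by blast
        show ?thesis
        proof (cases "u = b")
          case True
          then have "(a, v) \<in> (edges ?S)\<^sup>*" using u e by (meson converse_rtrancl_into_rtrancl)
          then show ?thesis using ab by blast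
        qed (use u in blast)
      qed
      moreover have "?S \<subseteq> literals_below k" using Suc.prems(3,4) ab by (auto intro!: xlit_below)
      moreover have "available_min \<Delta> ?S k u" if "u \<in> U - {b}" for u
        using Suc.prems(6)[of u] that by (auto intro: available_min_mono)
      ultimately show ?thesis
        using Suc.hyps(1)[of "U - {b}" ?S] Suc.prems ab by blast
    qed
    have lb: "leaf_bound \<le> 2 ^ m * Suc root_bound - 1"
    proof -
      have "Suc leaf_bound \<le> 1 * Suc root_bound" by (simp add: root_bound_def)
      also have "\<dots> \<le> 2 ^ m * Suc root_bound" by (intro mult_le_mono1) simp
      finally show ?thesis by simp
    qed
    have "var (xlit w u) \<in> vars (GGT n r s)" using uw Suc.prems(3) assms(2) by (intro var_xlit_mem) auto
    from closable_branch[OF this less[of u w] _ lb, of "2 ^ m * Suc root_bound - 1"] less[of w u] uw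
    have "closable \<Delta> S (Suc ((2 ^ m * Suc root_bound - 1) + (2 ^ m * Suc root_bound - 1)))"
      by (simp add: neg_xlit)
    \<comment> \<open>The bound is stated with a final \<open>- 1\<close> so that joining two halves
      by one inference reproduces its form.\<close>
    moreover have "Suc ((N - 1) + (N - 1)) \<le> 2 * N - 1" if "N > 0" for N :: nat using that by linarith
    ultimately show ?thesis unfolding Suc.hyps(2)[symmetric] power_Suc mult.assoc
      by (rule closable_mono) simp
  qed
qed

section \<open>Branching on three pool vertices\<close>

definition path2 :: "(nat \<times> nat) lit set \<Rightarrow> nat \<Rightarrow> nat \<Rightarrow> nat \<Rightarrow> (nat \<times> nat) lit set" where
  "path2 S a b c = insert (xlit c b) (insert (xlit b a) S)"

text \<open>Suppose \<open>a\<close> was decided to precede \<open>b\<close>. If \<open>b\<close>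
  precedes \<open>c\<close>, the path \<open>a\<close>, \<open>b\<close>, \<open>c\<close> is
  complete; otherwise comparing \<open>c\<close> with \<open>a\<close> completes \<open>c\<close>,
  \<open>a\<close>, \<open>b\<close> or \<open>a\<close>, \<open>c\<close>, \<open>b\<close>. So
  each answer to the first comparison needs three leaves and two inferences.\<close>

lemma closable_paths:
  assumes dt: "distinct_triple n u v w"
    and up: "\<And>a b c. {a, b, c} = {u, v, w} \<Longrightarrow> distinct [a, b, c] \<Longrightarrow> up \<Delta> (path2 S a b c)"
  shows "closable \<Delta> S (6 * leaf_bound + 5)"
proof -
  have half: "closable \<Delta> (insert (xlit b a) S) (3 * leaf_bound + 2)"
    if abc: "{a, b, c} = {u, v, w}" "distinct [a, b, c]" for a b c
  proof -
    have lt: "a < n" "b < n" "c < n" using dt abc(1) by (auto simp: distinct_triple_def)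
    let ?S = "insert (xlit b a) S"
    have p: "up \<Delta> (path2 S c a b)" "up \<Delta> (path2 S a c b)" "up \<Delta> (path2 S a b c)"
      by (rule up; use abc in auto)+
    have 1: "closable \<Delta> (insert (xlit c b) ?S) leaf_bound"
      using p(3) by (intro closable_up) (simp add: path2_def)
    have 2: "closable \<Delta> (insert (xlit a c) (insert (xlit b c) ?S)) leaf_bound"
      by (rule closable_up, rule up_mono[OF p(1) order_refl]) (auto simp: path2_def)
    have 3: "closable \<Delta> (insert (neg (xlit a c)) (insert (xlit b c) ?S)) leaf_bound"
      by (rule closable_up, rule up_mono[OF p(2) order_refl]) (use abc in \<open>auto simp: path2_def neg_xlit\<close>)
    have "closable \<Delta> (insert (neg (xlit c b)) ?S) (Suc (leaf_bound + leaf_bound))"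
      using closable_branch[OF var_xlit_mem 2 3 order_refl] lt abc by (simp add: neg_xlit)
    from closable_branch[OF var_xlit_mem 1 this order_refl]
    have "closable \<Delta> ?S (Suc (leaf_bound + Suc (leaf_bound + leaf_bound)))" using lt abc by simp
    then show ?thesis by (rule closable_mono) simp
  qed
  have d: "u < n" "v < n" "u \<noteq> v" "distinct [v, u, w]" "distinct [u, v, w]"
    using dt by (auto simp: distinct_triple_def)
  have "closable \<Delta> (insert (neg (xlit v u)) S) (3 * leaf_bound + 2)"
    using half[of v u w] d by (auto simp: neg_xlit)
  from closable_branch[OF var_xlit_mem half[of u v w] this] d
  have "closable \<Delta> S (Suc ((3 * leaf_bound + 2) + (3 * leaf_bound + 2)))" by simp
  then show ?thesis by (rule closable_mono) simp
qed

text \<open>Vertices from \<open>k\<close> on do not occur in \<open>S\<close>.\<close>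

definition pool :: "(nat \<times> nat) lit set \<Rightarrow> nat \<Rightarrow> nat set \<Rightarrow> bool" where
  "pool S k U \<longleftrightarrow> consistent S \<and> S \<subseteq> literals_below k \<and> k \<le> n \<and> U \<subseteq> {..<k} \<and> card U \<le> 6 \<and>
     (\<forall>u\<in>U. \<forall>j. j \<noteq> u \<longrightarrow> xlit u j \<notin> S) \<and> (\<forall>v<k. \<exists>u\<in>U. (u, v) \<in> (edges S)\<^sup>*)"

lemma pool_finite: "pool S k U \<Longrightarrow> finite U"
  unfolding pool_def by (meson finite_lessThan finite_subset)

lemma literals_below_mono: "k \<le> k' \<Longrightarrow> literals_below k \<subseteq> literals_below k'"
  unfolding literals_below_def by (smt (verit) Collect_mono less_le_trans)

text \<open>A vertex not yet seen has no edges and can join the pool as a source. This moves it from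
  one summand of \<open>card U + (n - k)\<close> to the other, so only the elimination of pool
  vertices lowers this measure.\<close>

lemma pool_fill:
  assumes "pool S k U"
  shows "\<exists>k' U'. pool S k' U' \<and> (k' < n \<longrightarrow> card U' = 6) \<and> card U' + (n - k') = card U + (n - k)"
  using assms
proof (induction "n - k" arbitrary: k U)
  case 0
  then show ?case by (intro exI[of _ k] exI[of _ U]) auto
next
  case (Suc d)
  show ?case
  proof (cases "card U = 6")
    case True
    then show ?thesis using Suc.prems by blast
  next
    case False
    have k: "k < n" "k \<notin> U" using Suc.hyps(2) Suc.prems by (auto simp: pool_def)
    then have card: "card (insert k U) = Suc (card U)" using pool_finite[OF Suc.prems] by simp
    have "xlit k j \<notin> S" if "j \<noteq> k" for j
      using that Suc.prems xlit_belowD[of k j k] by (auto simp: pool_def)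
    moreover have "\<exists>u\<in>insert k U. (u, v) \<in> (edges S)\<^sup>*" if "v < Suc k" for v
      using that Suc.prems by (cases "v = k") (auto simp: pool_def)
    ultimately have "pool S (Suc k) (insert k U)"
      using Suc.prems k False card literals_below_mono[of k "Suc k"]
      unfolding pool_def by (auto simp: less_Suc_eq)
    moreover have "d = n - Suc k" using Suc.hyps(2) by simp
    ultimately obtain k' U' where "pool S k' U'" "k' < n \<longrightarrow> card U' = 6"
      "card U' + (n - k') = card (insert k U) + (n - Suc k)"
      using Suc.hyps(1)[of "Suc k" "insert k U"] by blast
    then show ?thesis using card k(1) by (intro exI[of _ k'] exI[of _ U']) simp
  qed
qed

lemma pool_restrict:
  assumes "pool S k U" "S \<subseteq> S'" "consistent S'" "S' \<subseteq> literals_below k" "U' \<subseteq> U"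
    "\<And>u j. u \<in> U' \<Longrightarrow> j \<noteq> u \<Longrightarrow> xlit u j \<notin> S'"
    "\<And>u. u \<in> U \<Longrightarrow> \<exists>u'\<in>U'. (u', u) \<in> (edges S')\<^sup>*"
  shows "pool S' k U'"
proof -
  have "card U' \<le> card U" using assms(5) pool_finite[OF assms(1)] by (rule card_mono[rotated])
  moreover have "\<exists>u\<in>U'. (u, v) \<in> (edges S')\<^sup>*" if v: "v < k" for v
  proof -
    obtain u where u: "u \<in> U" "(u, v) \<in> (edges S')\<^sup>*"
      using assms(1) v edges_mono[OF assms(2)] unfolding pool_def by blast
    then show ?thesis using assms(7)[OF u(1)] by (meson rtrancl_trans)
  qed
  ultimately show ?thesis using assms unfolding pool_def by auto
qed

text \<open>A path \<open>a\<close>, \<open>b\<close>, \<open>c\<close> without conflict permits the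
  comb of \<open>amortized_branch3\<close>, whose tip is the 3-cycle and is closed by
  \<open>learn\<close>. In each open branch the last edge is reversed, some pool vertex has gained a
  predecessor, and \<open>IH\<close> applies to the smaller pool. Without such a path, six leaves
  close the node.\<close>

lemma pool_step:
  assumes \<phi>: "antimono \<phi>" and \<Delta>: "extends \<Delta>" and pool: "pool S k U"
    and uvw: "u \<in> U" "v \<in> U" "w \<in> U" "distinct [u, v, w]"
    and nup: "\<not> up \<Delta> S" and Q: "6 * leaf_bound + 5 \<le> Q"
    and learn: "\<And>a b c. {a, b, c} = {u, v, w} \<Longrightarrow> distinct [a, b, c] \<Longrightarrow> consistent (S \<union> T a b c) \<Longrightarrow>
      \<exists>t. refutes \<Delta> (S \<union> T a b c) t \<and> proof_size t + 3 \<le> Q \<and> \<phi> (\<Delta> \<union> learned t) < \<phi> \<Delta>"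
    and IH: "\<And>\<Delta>' S' k' U'. \<Delta> \<subseteq> \<Delta>' \<Longrightarrow> extends \<Delta>' \<Longrightarrow> S \<subseteq> S' \<Longrightarrow> pool S' k' U' \<Longrightarrow>
      (k' < n \<Longrightarrow> card U' = 6) \<Longrightarrow> card U' + (n - k') < card U + (n - k) \<Longrightarrow> amortized \<phi> Q \<Delta>' S'"
  shows "amortized \<phi> Q \<Delta> S"
proof (cases "\<exists>a b c. {a, b, c} = {u, v, w} \<and> distinct [a, b, c] \<and> \<not> up \<Delta> (path2 S a b c)")
  case False
  have k: "u < k" "v < k" "w < k" "k \<le> n" using pool uvw unfolding pool_def by auto
  then have "distinct_triple n u v w" using uvw by (auto simp: distinct_triple_def)
  then have "closable \<Delta> S (6 * leaf_bound + 5)" using False by (intro closable_paths) blast+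
  then obtain t where "refutes \<Delta> S t" "proof_size t \<le> 6 * leaf_bound + 5"
    using closableD[of \<Delta> S] pool \<Delta> unfolding pool_def by blast
  then show ?thesis using Q by (intro amortizedI) auto
next
  case True
  then obtain a b c where abc: "{a, b, c} = {u, v, w}" "distinct [a, b, c]"
    and path: "\<not> up \<Delta> (path2 S a b c)" by blast
  have "{a, b, c} \<subseteq> U" using uvw unfolding abc(1) by simp
  then have abcU: "a \<in> U" "b \<in> U" "c \<in> U" by auto
  then have k: "a < k" "b < k" "c < k" "k \<le> n" using pool unfolding pool_def by auto
  have ne: "a \<noteq> b" "b \<noteq> c" "a \<noteq> c" using abc by auto
  have und: "xlit x y \<notin> S" if "x \<in> U" "x \<noteq> y" for x y using pool that unfolding pool_def by auto
  have fresh: "var (xlit x y) \<notin> var ` S" if "x \<in> U" "y \<in> U" "x \<noteq> y" for x y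
    using that und by (simp add: var_image_iff neg_xlit)
  have c: "consistent S" and below: "S \<subseteq> literals_below k" using pool unfolding pool_def by auto
  \<comment> \<open>Refilling preserves the measure, so a strictly smaller pool stays below the
    original one after it has been refilled.\<close>
  have opn: "amortized \<phi> Q \<Delta>' S'"
    if "\<Delta> \<subseteq> \<Delta>'" "extends \<Delta>'" "S \<subseteq> S'" "consistent S'" "S' \<subseteq> literals_below k" "U' \<subset> U"
      "\<And>u j. u \<in> U' \<Longrightarrow> j \<noteq> u \<Longrightarrow> xlit u j \<notin> S'"
      "\<And>u. u \<in> U \<Longrightarrow> \<exists>u'\<in>U'. (u', u) \<in> (edges S')\<^sup>*" for \<Delta>' S' U'
  proof -
    have "pool S' k U'" using pool_restrict[OF pool, of S' U'] that by blast
    then obtain k'' U'' where p: "pool S' k'' U''" "k'' < n \<longrightarrow> card U'' = 6"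
      "card U'' + (n - k'') = card U' + (n - k)" using pool_fill by blast
    have "card U' < card U" using that(6) pool_finite[OF pool] by (rule psubset_card_mono[rotated])
    then show ?thesis using IH[of \<Delta>' S' k'' U''] that p by auto
  qed
  let ?x = "xlit b a" and ?y = "xlit c b" and ?z = "xlit a c"
  have vx: "var ?x \<notin> var ` S" and vy: "var ?y \<notin> var ` insert ?x S"
    and vz: "var ?z \<notin> var ` insert ?y (insert ?x S)"
    using abcU ne fresh by (auto simp: var_xlit_eq_iff)
  have cx: "consistent (insert ?x S)" "consistent (insert (neg ?x) S)"
    using c vx by (auto intro: consistent_insert)
  have cy: "consistent (insert ?y (insert ?x S))" "consistent (insert (neg ?y) (insert ?x S))"
    using cx(1) vy by (auto intro: consistent_insert simp del: image_insert)
  have cz: "consistent (insert ?z (insert ?y (insert ?x S)))"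
    "consistent (insert (neg ?z) (insert ?y (insert ?x S)))"
    using cy(1) vz by (auto intro: consistent_insert simp del: image_insert)
  have T: "S \<union> T a b c = insert ?z (insert ?y (insert ?x S))" using abc(2) by (auto simp: T_eq)
  have neg: "neg ?x = xlit a b" "neg ?y = xlit b c" "neg ?z = xlit c a" using ne by (auto simp: neg_xlit)
  obtain t0 where t0: "refutes \<Delta> (insert ?z (insert ?y (insert ?x S))) t0" "proof_size t0 + 3 \<le> Q"
    "\<phi> (\<Delta> \<union> learned t0) < \<phi> \<Delta>"
    using learn[OF abc] cz(1) unfolding T by blast
  have below': "xlit x y \<in> literals_below k" if "x \<in> {a, b, c}" "y \<in> {a, b, c}" "x \<noteq> y" for x y
    using that k by (auto intro: xlit_below)
  have mem: "var ?x \<in> vars (GGT n r s)" "var ?y \<in> vars (GGT n r s)" "var ?z \<in> vars (GGT n r s)"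
    using k ne by (auto intro!: var_xlit_mem)
  show ?thesis
  proof (rule amortized_branch3[OF \<phi> \<Delta> _ mem(1) vx mem(2) vy mem(3) vz t0])
    show "\<not> up \<Delta> (insert ?y (insert ?x S))" using path by (simp add: path2_def)
  next
    fix \<Delta>' assume d: "\<Delta> \<subseteq> \<Delta>'" "extends \<Delta>'"
    let ?S = "insert (neg ?z) (insert ?y (insert ?x S))"
    show "amortized \<phi> Q \<Delta>' ?S"
    \<comment> \<open>Now \<open>a\<close> precedes both \<open>b\<close> and \<open>c\<close>, so
      both leave the pool.\<close>
    proof (rule opn[OF d, of _ "U - {b, c}"])
      show "?S \<subseteq> literals_below k" using below ne unfolding neg by (auto intro: below')
      show "U - {b, c} \<subset> U" using abcU by blast
      show "xlit x j \<notin> ?S" if "x \<in> U - {b, c}" "j \<noteq> x" for x j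
        using that und ne unfolding neg by (auto simp: xlit_eq_iff)
      have "(a, b) \<in> edges ?S" "(a, c) \<in> edges ?S" using ne unfolding neg by (auto simp: edges_def)
      then show "\<exists>u'\<in>U - {b, c}. (u', x) \<in> (edges ?S)\<^sup>*" if "x \<in> U" for x
        using that abcU ne by (cases "x = b \<or> x = c") blast+
    qed (use cz in auto)
  next
    fix \<Delta>' assume d: "\<Delta> \<subseteq> \<Delta>'" "extends \<Delta>'"
    let ?S = "insert (neg ?y) (insert ?x S)"
    show "amortized \<phi> Q \<Delta>' ?S"
    \<comment> \<open>Here \<open>b\<close> is preceded by \<open>a\<close> and by \<open>c\<close>,
      while these two remain without predecessors.\<close>
    proof (rule opn[OF d, of _ "U - {b}"])
      show "?S \<subseteq> literals_below k" using below ne unfolding neg by (auto intro: below')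
      show "U - {b} \<subset> U" using abcU by blast
      show "xlit x j \<notin> ?S" if "x \<in> U - {b}" "j \<noteq> x" for x j
        using that und ne unfolding neg by (auto simp: xlit_eq_iff)
      have "(a, b) \<in> edges ?S" using ne by (auto simp: edges_def)
      then show "\<exists>u'\<in>U - {b}. (u', x) \<in> (edges ?S)\<^sup>*" if "x \<in> U" for x
        using that abcU ne by (cases "x = b") blast+
    qed (use cy in auto)
  next
    fix \<Delta>' assume d: "\<Delta> \<subseteq> \<Delta>'" "extends \<Delta>'"
    let ?S = "insert (neg ?x) S"
    show "amortized \<phi> Q \<Delta>' ?S"
    proof (rule opn[OF d, of _ "U - {a}"])
      show "?S \<subseteq> literals_below k" using below ne unfolding neg by (auto intro: below')
      show "U - {a} \<subset> U" using abcU by blast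
      show "xlit x j \<notin> ?S" if "x \<in> U - {a}" "j \<noteq> x" for x j
        using that und ne unfolding neg by (auto simp: xlit_eq_iff)
      have "(b, a) \<in> edges ?S" using ne unfolding neg by (auto simp: edges_def)
      then show "\<exists>u'\<in>U - {a}. (u', x) \<in> (edges ?S)\<^sup>*" if "x \<in> U" for x
        using that abcU ne by (cases "x = a") blast+
    qed (use cx in auto)
  qed
qed

section \<open>Learning triangles\<close>

lemma guard_facts:
  assumes "distinct_triple n i j k"
  shows "r i j k < n" "s i j k < n" "r i j k \<noteq> s i j k"
    "var (xlit (r i j k) (s i j k)) \<notin> var ` T i j k"
proof -
  have d: "i < n" "j < n" "k < n" "distinct [i, j, k]" using assms by (auto simp: distinct_triple_def)
  show g: "r i j k < n" "s i j k < n" "r i j k \<noteq> s i j k"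
    using guards assms d unfolding guards_def by auto
  have "\<not> {r i j k, s i j k} \<subseteq> {i, j, k}" using guards assms unfolding guards_def by blast
  then show "var (xlit (r i j k) (s i j k)) \<notin> var ` T i j k"
    using d g(3) by (auto simp: T_eq var_xlit_eq_iff)
qed

lemma guard_derivation:
  assumes dt: "distinct_triple n i j k" and \<Delta>: "GGT n r s \<subseteq> \<Delta>"
    and g: "var (xlit (r i j k) (s i j k)) \<notin> var ` S"
  shows "\<exists>D. derivation (vars (GGT n r s)) \<Delta> S D \<and> concl D = T i j k \<and> proof_size D = 3 \<and>
    resolved_vars D = {var (xlit (r i j k) (s i j k))}"
proof -
  let ?g = "xlit (r i j k) (s i j k)"
  let ?D = "Resolve ?g (Leaf (insert ?g (T i j k))) (Leaf (insert (neg ?g) (T i j k)))"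
  have nT: "?g \<notin> T i j k" "neg ?g \<notin> T i j k"
    using guard_facts(4)[OF dt] by (auto simp: var_image_iff)
  then have "concl ?D = T i j k" by auto
  moreover have "derivation (vars (GGT n r s)) \<Delta> S ?D"
    using nT g guard_clause_mem[OF dt] \<Delta> var_xlit_mem[OF guard_facts(1-3)[OF dt]]
    by (auto simp: derivation_def)
  ultimately show ?thesis by (intro exI[of _ ?D]) auto
qed

text \<open>The first disjunct includes the case that the guard of the triangle is assigned in \<open>S\<close>.\<close>

definition settled :: "(nat \<times> nat) clause set \<Rightarrow> (nat \<times> nat) lit set \<Rightarrow> nat \<Rightarrow> nat \<Rightarrow> nat \<Rightarrow> bool" where
  "settled \<Delta> S i j k \<longleftrightarrow> (\<exists>C\<in>\<Delta>. C \<subseteq> T i j k \<union> S) \<or> (\<exists>l\<in>T i j k. neg l \<in> S)"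

lemma settled_mono: "settled \<Delta> S i j k \<Longrightarrow> \<Delta> \<subseteq> \<Delta>' \<Longrightarrow> settled \<Delta>' S i j k"
  unfolding settled_def by blast

text \<open>If the guard were assigned in \<open>S\<close>, one of the two guard clauses would have
  its guard literal in \<open>S\<close> and would be the excluded clause.\<close>

lemma guard_not_settled:
  assumes "distinct_triple n i j k" "GGT n r s \<subseteq> \<Delta>" "\<nexists>C. C \<in> \<Delta> \<and> C \<subseteq> T i j k \<union> S"
  shows "var (xlit (r i j k) (s i j k)) \<notin> var ` S"
  using guard_clause_mem[OF assms(1), of r s] assms(2,3) by (auto simp: var_image_iff)

lemma finite_below: "S \<subseteq> literals_below k \<Longrightarrow> finite S"
proof (rule finite_subset)
  have "literals_below k \<subseteq> (\<lambda>(a, b). xlit a b) ` ({..<k} \<times> {..<k})"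
    by (auto simp: literals_below_def)
  then show "finite (literals_below k)" by (rule finite_subset) simp
qed

lemma T_below: "distinct_triple n i j k \<Longrightarrow> T i j k \<subseteq> literals_below n"
  by (auto simp: distinct_triple_def T_eq xlit_below)

lemma vars_below: "S \<subseteq> literals_below n \<Longrightarrow> var ` S \<subseteq> vars (GGT n r s)"
  unfolding literals_below_def vars_GGT[OF guards] by blast

lemma consistent_T: "distinct_triple n i j k \<Longrightarrow> consistent (T i j k)"
  by (auto simp: distinct_triple_def T_eq consistent_def neg_xlit xlit_eq_iff)

text \<open>If no available clause is falsified at the 3-cycle, then \<open>T a b c\<close> itself
  is new, its guard is unassigned, and one inference learns it. Otherwise a falsified clause exists
  against which the literals of \<open>T i j k\<close> can be resolved away, so that
  \<open>T i j k\<close> is learned; the disjointness conditions keep its variables and its guard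
  clear of the cycle.\<close>

lemma learn_triangle:
  assumes ijk: "distinct_triple n i j k" "\<not> settled \<Delta> S i j k" and abc: "distinct_triple n a b c"
    and S: "consistent (S \<union> T a b c)" "S \<subseteq> literals_below n" and \<Delta>: "extends \<Delta>"
    and disj: "var ` T a b c \<inter> var ` S = {}" "var ` T a b c \<inter> var ` T i j k = {}"
      "var (xlit (r i j k) (s i j k)) \<notin> var ` T a b c"
  shows "\<exists>t. refutes \<Delta> (S \<union> T a b c) t \<and> proof_size t \<le> 9 \<and>
    (\<exists>x y z. distinct_triple n x y z \<and> T x y z \<notin> \<Delta> \<and> T x y z \<in> learned t)"
proof -
  let ?S = "S \<union> T a b c"
  have \<Gamma>: "GGT n r s \<subseteq> \<Delta>" using \<Delta> by (simp add: extends_def)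
  show ?thesis
  proof (cases "\<exists>C. C \<in> \<Delta> \<and> C \<subseteq> T a b c \<union> S")
    case False
    have "var (xlit (r a b c) (s a b c)) \<notin> var ` ?S"
      using guard_not_settled[OF abc \<Gamma> False] guard_facts(4)[OF abc] by auto
    then obtain D where D: "derivation (vars (GGT n r s)) \<Delta> ?S D" "concl D = T a b c" "proof_size D = 3"
      using guard_derivation[OF abc \<Gamma>] by blast
    have "refutes \<Delta> ?S D" using D by (intro good_derivation) auto
    moreover have "T a b c \<notin> \<Delta>" using False by blast
    moreover have "T a b c \<in> learned D" using D concl_in_learned[of D] by (auto simp: derivation_def)
    ultimately show ?thesis using abc D(3) by (intro exI[of _ D]) auto
  next
    case True
    then obtain C where C: "C \<in> \<Delta>" "C \<subseteq> ?S" by blast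
    have ns: "\<nexists>C. C \<in> \<Delta> \<and> C \<subseteq> T i j k \<union> S" "\<And>l. l \<in> T i j k \<Longrightarrow> neg l \<notin> S"
      using ijk(2) unfolding settled_def by blast+
    have g: "var (xlit (r i j k) (s i j k)) \<notin> var ` ?S"
      using guard_not_settled[OF ijk(1) \<Gamma> ns(1)] disj(3) by auto
    obtain D where D: "derivation (vars (GGT n r s)) \<Delta> ?S D" "concl D = T i j k" "proof_size D = 3"
      "resolved_vars D = {var (xlit (r i j k) (s i j k))}"
      using guard_derivation[OF ijk(1) \<Gamma> g] by blast
    have fin: "finite (T i j k)" using finite_below[OF T_below[OF ijk(1)]] .
    have below: "?S \<subseteq> literals_below n" using S(2) T_below[OF abc] by blast
    have "neg l \<notin> ?S" if "l \<in> T i j k" for l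
      using ns(2)[OF that] disj(2) that var_neg[of l] by (metis IntI UnE emptyE imageI)
    then have "\<exists>D'. derivation (vars (GGT n r s)) \<Delta> ?S D' \<and> concl D' \<subseteq> ?S \<and> learned D \<subseteq> learned D' \<and>
      proof_size D' = proof_size D + 2 * card (concl D - ?S)"
      using D(2-) fin consistent_T[OF ijk(1)] vars_below[OF T_below[OF ijk(1)]]
        guard_facts(4)[OF ijk(1)] finite_subset[OF C(2) finite_below[OF below]]
        subset_trans[OF image_mono[OF C(2)] vars_below[OF below]]
      by (intro phantom_derivation[OF D(1) _ _ _ _ _ C _ S(1)]) auto
    then obtain D' where D': "derivation (vars (GGT n r s)) \<Delta> ?S D'" "concl D' \<subseteq> ?S"
      "learned D \<subseteq> learned D'" "proof_size D' = proof_size D + 2 * card (concl D - ?S)" by blast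
    \<comment> \<open>The inference on the guard has three clauses, and removing each of at most
      three literals adds two, which makes 9.\<close>
    have "card (concl D - ?S) \<le> card (T i j k)" unfolding D(2) using fin by (intro card_mono) auto
    also have "\<dots> \<le> 3" unfolding T_def by (simp add: card_insert_if)
    finally have "proof_size D' \<le> 9" using D' D(3) by simp
    moreover have "T i j k \<in> learned D'"
      using D' D concl_in_learned[of D] by (auto simp: derivation_def)
    moreover have "T i j k \<notin> \<Delta>" using ns(1) by blast
    ultimately show ?thesis using D' ijk(1) good_derivation by blast
  qed
qed

section \<open>Learning minimum clauses\<close>

lemma consistent_card: "consistent S \<Longrightarrow> finite V \<Longrightarrow> var ` S \<subseteq> V \<Longrightarrow> card S \<le> card V"
  by (rule card_inj_on_le[of var]) (auto simp: inj_on_def var_eq_iff consistent_def)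

text \<open>Suppose \<open>m\<close> precedes all other vertices below \<open>k'\<close>. By the
  clause for \<open>m\<close> at \<open>Suc k'\<close>, the vertex \<open>k'\<close> precedes
  \<open>m\<close>; by the triangles it then precedes all vertices below it, against the clause for
  \<open>k'\<close>. This is a propagation, so it gives an input derivation of the wanted clause
  weakened by literals of \<open>S0\<close>, and phantom literals allow it to be placed at the
  3-cycle.\<close>

lemma learn_min:
  assumes S0: "S0 \<subseteq> S" "\<And>x y z. distinct_triple n x y z \<Longrightarrow> settled \<Delta> S0 x y z"
    and pool: "pool S k U" and \<Delta>: "extends \<Delta>"
    and km: "k \<le> k'" "k' < n" "m < k'" "m \<in> U \<or> k \<le> m"
    and avail: "available_min \<Delta> S0 (Suc k') m" "available_min \<Delta> S0 (Suc k') k'"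
    and abc: "a \<in> U - {m}" "b \<in> U - {m}" "c \<in> U - {m}" "distinct [a, b, c]"
    and con: "consistent (S \<union> T a b c)"
  shows "\<exists>t. refutes \<Delta> (S \<union> T a b c) t \<and> proof_size t \<le> 2 * leaf_bound \<and>
    available_min (\<Delta> \<union> learned t) S0 k' m"
proof -
  let ?S = "S \<union> T a b c" and ?V = "vars (GGT n r s)"
  let ?L = "{xlit j m | j. j < k' \<and> j \<noteq> m}"
  let ?E = "{var (xlit k' j) | j. j < k'}"
  \<comment> \<open>The derivation is built relative to \<open>S0\<close> and the wanted clause, but
    is to be used below the larger set \<open>S \<union> T a b c\<close>. Restricting the clauses
    leaves only variables at \<open>k'\<close> to resolve on, and these do not occur on the path
    because \<open>k \<le> k'\<close>.\<close>
  define \<Delta>0 where "\<Delta>0 = {C \<in> \<Delta>. var ` C \<subseteq> var ` (S0 \<union> ?L) \<union> ?E}"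
  have lt: "a < k" "b < k" "c < k" "k \<le> n" using pool abc unfolding pool_def by auto
  have below: "?S \<subseteq> literals_below k"
    using pool abc lt unfolding pool_def by (auto simp: T_eq xlit_below)
  have S0k: "S0 \<subseteq> literals_below k" using S0(1) below by blast
  \<comment> \<open>No literal of the wanted clause is true on the path: \<open>m\<close> is not on
    the cycle, and it is either a pool vertex, hence without predecessor, or unseen.\<close>
  have und: "xlit m j \<notin> ?S" if "j \<noteq> m" for j
  proof (cases "m \<in> U")
    case True
    then have "xlit m j \<notin> S" using pool that unfolding pool_def by auto
    then show ?thesis using abc that by (auto simp: T_eq xlit_eq_iff)
  next
    case False
    then show ?thesis using km(4) below that xlit_belowD[of m j k] by auto
  qed
  have con1: "consistent (S0 \<union> ?L)"
  proof -
    have c0: "consistent S0" by (rule consistent_subset[OF con]) (use S0(1) in blast)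
    show ?thesis unfolding consistent_def
    proof (intro ballI notI)
      fix l assume l: "l \<in> S0 \<union> ?L" "neg l \<in> S0 \<union> ?L"
      then consider "l \<in> S0" "neg l \<in> S0"
        | j where "j \<noteq> m" "xlit m j \<in> S0"
        | i j where "i \<noteq> m" "j \<noteq> m" "xlit i m = neg (xlit j m)"
        by (auto simp: neg_xlit) (metis neg_neg neg_xlit)
      then show False
      proof cases
        case 1 then show ?thesis using c0 by (auto simp: consistent_def)
      next
        case 2 then show ?thesis using und S0(1) by auto
      next
        case 3 then show ?thesis by (auto simp: neg_xlit xlit_eq_iff)
      qed
    qed
  qed
  have up0: "up \<Delta>0 (S0 \<union> ?L)"
  proof -
    let ?S1 = "insert (xlit m k') (S0 \<union> ?L)"
    obtain C1 C2 where C1: "C1 \<in> \<Delta>" "C1 \<subseteq> S0 \<union> {xlit j m | j. j < Suc k' \<and> j \<noteq> m}"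
      and C2: "C2 \<in> \<Delta>" "C2 \<subseteq> S0 \<union> {xlit j k' | j. j < Suc k' \<and> j \<noteq> k'}"
      using avail unfolding available_min_def by blast
    have vs: "var (xlit j k') = var (xlit k' j)" if "j < k'" for j
      using that by (simp add: var_xlit_eq_iff)
    have C1': "C1 \<subseteq> insert (xlit k' m) (S0 \<union> ?L)" using C1(2) km(3) by (auto simp: less_Suc_eq)
    have C2': "C2 \<subseteq> S0 \<union> {xlit j k' | j. j < k'}" using C2(2) by (auto simp: less_Suc_eq)
    have "C1 \<in> \<Delta>0" unfolding \<Delta>0_def using C1(1) C1' km(3) by auto
    have vE: "var l \<in> ?E" if "l \<in> {xlit j k' | j. j < k'}" for l using that vs by blast
    have "var l \<in> var ` (S0 \<union> ?L) \<union> ?E" if "l \<in> C2" for l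
      using subsetD[OF C2' that] vE by blast
    then have "C2 \<in> \<Delta>0" unfolding \<Delta>0_def using C2(1) by blast
    \<comment> \<open>With \<open>k'\<close> before \<open>m\<close>, the triangles on
      \<open>k'\<close>, \<open>m\<close>, \<open>j\<close> are unit for all \<open>j\<close>
      simultaneously, and together they falsify \<open>C2\<close>.\<close>
    have "up \<Delta>0 ?S1"
    proof (rule up_propagate_set)
      let ?X = "{xlit k' j | j. j < k' \<and> j \<noteq> m}"
      show "finite ?X" by simp
      show "\<exists>C\<in>\<Delta>0. C \<subseteq> insert l ?S1" if l: "l \<in> ?X" for l
      proof -
        obtain j where j: "l = xlit k' j" "j < k'" "j \<noteq> m" using l by blast
        have d: "distinct [k', m, j]" using j km by auto
        have dt: "distinct_triple n k' m j" using d j km by (auto simp: distinct_triple_def)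
        have "neg l \<notin> S0" if "l \<in> T k' m j" for l
        proof -
          have "l = xlit m k' \<or> l = xlit j m \<or> l = xlit k' j" using that d by (auto simp: T_eq)
          moreover have "xlit k' m \<notin> S0" "xlit j k' \<notin> S0"
            using S0k km(1) d xlit_belowD[of k' m k] xlit_belowD[of j k' k] by auto
          moreover have "xlit m j \<notin> S0" using und j S0(1) by auto
          ultimately show ?thesis using d by (auto simp: neg_xlit)
        qed
        then obtain C where C: "C \<in> \<Delta>" "C \<subseteq> T k' m j \<union> S0"
          using S0(2)[OF dt] unfolding settled_def by blast
        have C': "C \<subseteq> {xlit m k', xlit j m, xlit k' j} \<union> S0" using C(2) d by (simp add: T_eq)
        have "var l \<in> var ` (S0 \<union> ?L) \<union> ?E" if "l \<in> C" for l
        proof -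
          from subsetD[OF C' that] consider "l = xlit m k'" | "l \<in> ?L" | "l = xlit k' j" | "l \<in> S0"
            using j(2,3) by blast
          then show ?thesis
          proof cases
            case 1 then show ?thesis using vs[OF km(3)] km(3) by auto
          qed (use j(2) in blast)+
        qed
        then have "C \<in> \<Delta>0" using C(1) unfolding \<Delta>0_def by blast
        moreover have "C \<subseteq> insert l ?S1" using C' j by auto
        ultimately show ?thesis by blast
      qed
      have "xlit j k' \<in> insert (xlit m k') (neg ` ?X)" if "j < k'" for j
        using that by (cases "j = m") (auto intro!: image_eqI[of _ _ "xlit k' j"] simp: neg_xlit)
      then have "C2 \<subseteq> ?S1 \<union> neg ` ?X" using C2' by blast
      then show "up \<Delta>0 (?S1 \<union> neg ` ?X)" using \<open>C2 \<in> \<Delta>0\<close> by (rule up.conflict[rotated])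
    qed
    then show ?thesis
      using up.propagate[OF \<open>C1 \<in> \<Delta>0\<close> C1'] km(3) by (simp add: neg_xlit)
  qed
  have "vars \<Delta>0 \<subseteq> vars \<Delta>" unfolding vars_def \<Delta>0_def by (intro UN_mono) auto
  then have V0: "vars \<Delta>0 \<subseteq> ?V" using \<Delta> unfolding extends_def by blast
  then obtain D where D: "derivation (vars \<Delta>0) \<Delta>0 (S0 \<union> ?L) D" "concl D \<subseteq> S0 \<union> ?L"
    "proof_size D \<le> 2 * card (?V - var ` (S0 \<union> ?L)) + 1"
    using up_derivation[OF up0 con1 finite_vars] by blast
  have "card (?V - var ` (S0 \<union> ?L)) \<le> card ?V" using finite_vars by (intro card_mono) auto
  then have size: "proof_size D \<le> leaf_bound" using D(3) by (simp add: leaf_bound_def)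
  have disj_sub: "A \<subseteq> E" if "A \<subseteq> B \<union> E" "A \<inter> B = {}" for A B E :: "(nat \<times> nat) set"
    using that by blast
  have disj_mono: "A \<inter> C = {}" if "A \<inter> B = {}" "C \<subseteq> B" for A B C :: "(nat \<times> nat) set"
    using that by blast
  have disjD: "resolved_vars D \<inter> var ` (S0 \<union> ?L) = {}" using D(1) unfolding derivation_def by (elim conjE)
  have rvE: "resolved_vars D \<subseteq> ?E"
  proof -
    have "resolved_vars D \<subseteq> vars \<Delta>0" using D(1) by (auto simp: derivation_def dest: w_resolution_resolved_vars)
    also have "\<dots> \<subseteq> var ` (S0 \<union> ?L) \<union> ?E" unfolding vars_def \<Delta>0_def by blast
    finally show ?thesis using disjD by (rule disj_sub)
  qed
  have "?E \<inter> var ` ?S = {}"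
  proof -
    have "var (xlit k' j) \<notin> var ` ?S" if "j < k'" for j
      using that below km(1) xlit_belowD[of k' j k] xlit_belowD[of j k' k]
      by (auto simp: var_image_iff neg_xlit)
    then show ?thesis by blast
  qed
  then have "resolved_vars D \<inter> var ` ?S = {}"
    using disj_mono[of "var ` ?S" ?E "resolved_vars D"] rvE by (simp add: Int_commute)
  moreover have "leaves D \<subseteq> \<Delta>0" using D(1) unfolding derivation_def by (elim conjE)
  then have "leaves D \<subseteq> \<Delta>" by (rule order_trans) (auto simp: \<Delta>0_def)
  ultimately have derD: "derivation ?V \<Delta> ?S D"
    using D(1) w_resolution_mono[OF _ V0, of D] unfolding derivation_def by simp
  have dt: "distinct_triple n a b c" using lt abc by (auto simp: distinct_triple_def)
  \<comment> \<open>The falsified clause needed for phantom literals comes from the settled triangle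
    \<open>a\<close>, \<open>b\<close>, \<open>c\<close>; none of its literals is true under
    \<open>S0\<close>, so a clause for it is available.\<close>
  obtain C where C: "C \<in> \<Delta>" "C \<subseteq> ?S"
  proof -
    have "xlit x y \<notin> S0" if "x \<in> U" "x \<noteq> y" for x y
      using pool that S0(1) unfolding pool_def by auto
    then have "\<not> (\<exists>l\<in>T a b c. neg l \<in> S0)" using abc by (auto simp: T_eq neg_xlit)
    then obtain C where "C \<in> \<Delta>" "C \<subseteq> T a b c \<union> S0" using S0(2)[OF dt] unfolding settled_def by blast
    then show ?thesis using S0(1) by (intro that[of C]) auto
  qed
  have conc: "consistent (concl D)" using consistent_subset[OF con1 D(2)] .
  have Lb: "?L \<subseteq> literals_below n" using km by (auto intro: xlit_below)
  have Sb: "?S \<subseteq> literals_below n" using below literals_below_mono[OF lt(4)] by blast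
  have Db: "concl D \<subseteq> literals_below n" using D(2) Lb Sb S0(1) by blast
  have "neg l \<notin> ?S" if l: "l \<in> concl D" for l
  proof -
    consider "l \<in> S0" | j where "l = xlit j m" "j \<noteq> m" using subsetD[OF D(2) l] by blast
    then show ?thesis
    proof cases
      case 1 then show ?thesis using con S0(1) unfolding consistent_def by blast
    next
      case 2 then show ?thesis using und[of j] by (simp add: neg_xlit)
    qed
  qed
  moreover have "resolved_vars D \<inter> var ` concl D = {}"
    using disjD image_mono[OF D(2), of var] by (rule disj_mono)
  ultimately have "\<exists>D'. derivation ?V \<Delta> ?S D' \<and> concl D' \<subseteq> ?S \<and> learned D \<subseteq> learned D' \<and>
      proof_size D' = proof_size D + 2 * card (concl D - ?S)"
    using finite_subset[OF C(2) finite_below[OF Sb]]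
      subset_trans[OF image_mono[OF C(2)] vars_below[OF Sb]]
    by (intro phantom_derivation[OF derD finite_below[OF Db] conc vars_below[OF Db] _ _ C _ con])
  then obtain D' where D': "derivation ?V \<Delta> ?S D'" "concl D' \<subseteq> ?S" "learned D \<subseteq> learned D'"
    "proof_size D' = proof_size D + 2 * card (concl D - ?S)" by blast
  have "card (concl D - ?S) \<le> card (concl D)" using finite_below[OF Db] by (intro card_mono) auto
  also have "\<dots> \<le> card ?V" using consistent_card[OF conc finite_vars vars_below[OF Db]] .
  finally have "proof_size D' \<le> 2 * leaf_bound" using D'(4) size by (simp add: leaf_bound_def)
  moreover have "concl D \<in> learned D'"
    using D(1) D'(3) concl_in_learned[of D] by (auto simp: derivation_def)
  then have "available_min (\<Delta> \<union> learned D') S0 k' m" using D(2) unfolding available_min_def by blast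
  ultimately show ?thesis using D'(1,2) good_derivation by blast
qed

section \<open>Potentials counting missing clauses\<close>

text \<open>\<open>S\<close> is frozen when the search for minimum clauses starts and does not
  follow the path, so that a clause weakened by it counts in all later branches of that
  search.\<close>

definition missing_mins :: "(nat \<times> nat) lit set \<Rightarrow> (nat \<times> nat) clause set \<Rightarrow> nat" where
  "missing_mins S \<Delta> = card {(k, m). k < n \<and> m < n \<and> \<not> available_min \<Delta> S k m}"

definition missing_triangles :: "(nat \<times> nat) clause set \<Rightarrow> nat" where
  "missing_triangles \<Delta> = card {(i, j, k). distinct_triple n i j k \<and> T i j k \<notin> \<Delta>}"

lemma finite_missing_mins: "finite {(k, m). k < n \<and> m < n \<and> \<not> available_min \<Delta> S k m}"
  by (rule finite_subset[of _ "{..<n} \<times> {..<n}"]) auto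

lemma finite_missing_triangles: "finite {(i, j, k). distinct_triple n i j k \<and> T i j k \<notin> \<Delta>}"
  by (rule finite_subset[of _ "{..<n} \<times> {..<n} \<times> {..<n}"]) (auto simp: distinct_triple_def)

lemma antimono_missing_mins: "antimono (missing_mins S)"
  unfolding missing_mins_def
  by (intro antimonoI card_mono finite_missing_mins) (auto dest: available_min_mono)

lemma antimono_missing_triangles: "antimono missing_triangles"
  unfolding missing_triangles_def
  by (intro antimonoI card_mono finite_missing_triangles) auto

lemma missing_mins_less:
  assumes "\<Delta> \<subseteq> \<Delta>'" "k < n" "m < n" "\<not> available_min \<Delta> S k m" "available_min \<Delta>' S k m"
  shows "missing_mins S \<Delta>' < missing_mins S \<Delta>"
  unfolding missing_mins_def
proof (rule psubset_card_mono[OF finite_missing_mins])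
  show "{(k, m). k < n \<and> m < n \<and> \<not> available_min \<Delta>' S k m} \<subset>
    {(k, m). k < n \<and> m < n \<and> \<not> available_min \<Delta> S k m}" (is "?A \<subset> ?B")
  proof (rule psubsetI)
    have "(k, m) \<in> ?B" "(k, m) \<notin> ?A" using assms by auto
    then show "?A \<noteq> ?B" by blast
  qed (use assms in \<open>auto dest: available_min_mono\<close>)
qed

lemma missing_triangles_less:
  assumes "\<Delta> \<subseteq> \<Delta>'" "distinct_triple n i j k" "T i j k \<notin> \<Delta>" "T i j k \<in> \<Delta>'"
  shows "missing_triangles \<Delta>' < missing_triangles \<Delta>"
  unfolding missing_triangles_def
proof (rule psubset_card_mono[OF finite_missing_triangles])
  show "{(i, j, k). distinct_triple n i j k \<and> T i j k \<notin> \<Delta>'} \<subset>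
    {(i, j, k). distinct_triple n i j k \<and> T i j k \<notin> \<Delta>}" (is "?A \<subset> ?B")
  proof (rule psubsetI)
    have "(i, j, k) \<in> ?B" "(i, j, k) \<notin> ?A" using assms by auto
    then show "?A \<noteq> ?B" by blast
  qed (use assms in auto)
qed

lemma missing_mins_le: "missing_mins S \<Delta> \<le> n * n"
proof -
  have "missing_mins S \<Delta> \<le> card ({..<n} \<times> {..<n})"
    unfolding missing_mins_def by (intro card_mono) auto
  then show ?thesis by simp
qed

lemma missing_triangles_le: "missing_triangles \<Delta> \<le> n * n * n"
proof -
  have "missing_triangles \<Delta> \<le> card ({..<n} \<times> {..<n} \<times> {..<n})"
    unfolding missing_triangles_def by (intro card_mono) (auto simp: distinct_triple_def)
  then show ?thesis by simp
qed

section \<open>The two nested searches\<close>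

text \<open>The factor is \<open>2 ^ 6\<close>, from the tournament on a pool of at most six
  vertices.\<close>

definition close_bound :: nat where
  "close_bound = 64 * Suc root_bound"

text \<open>One margin for all uses: the six leaves with five inferences, a leaf learning a minimum
  clause with the three inferences of its comb, and 9 + 3 for a triangle.\<close>

lemma close_bound_ge: "6 * leaf_bound + 12 \<le> close_bound"
  unfolding close_bound_def root_bound_def by simp

lemma pool_close:
  assumes "pool S k U" "extends \<Delta>" "0 < n" "k < n \<Longrightarrow> card U = 6"
    "\<And>u. u \<in> U \<Longrightarrow> available_min \<Delta> S k u"
  obtains t where "refutes \<Delta> S t" "proof_size t \<le> close_bound"
proof -
  have ne: "U \<noteq> {}"
  proof (cases "k < n")
    case False
    then have "0 < k" using assms(3) by simp
    then show ?thesis using assms(1) unfolding pool_def by blast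
  qed (use assms(4) in auto)
  have \<Gamma>: "GGT n r s \<subseteq> \<Delta>" using assms(2) by (simp add: extends_def)
  have "closable \<Delta> S (2 ^ card U * Suc root_bound - 1)"
    by (rule closable_pool[OF \<Gamma> _ pool_finite[OF assms(1)] ne]) (use assms in \<open>auto simp: pool_def\<close>)
  moreover have "(2::nat) ^ card U \<le> 2 ^ 6"
    using assms(1) unfolding pool_def by (intro power_increasing) auto
  then have "2 ^ card U * Suc root_bound \<le> close_bound"
    unfolding close_bound_def by (intro mult_le_mono1) simp
  ultimately have "closable \<Delta> S close_bound" by (elim closable_mono) simp
  then show ?thesis using closableD[of \<Delta> S close_bound \<Delta>] assms(1,2) that unfolding pool_def by blast
qed

text \<open>The inner search, in which all triangles are settled. It always learns a missing clause
  with the largest possible \<open>k'\<close>, so that the premises at \<open>Suc k'\<close> are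
  available. Only vertices in the pool or unseen matter as \<open>m\<close>. Once the clauses at
  \<open>k\<close> are known for the pool, the tournament closes the branch.\<close>

lemma amortized_mins:
  assumes settled: "\<And>x y z. distinct_triple n x y z \<Longrightarrow> settled \<Delta>0 S0 x y z" and n: "0 < n"
  shows "\<Delta>0 \<subseteq> \<Delta> \<Longrightarrow> extends \<Delta> \<Longrightarrow> S0 \<subseteq> S \<Longrightarrow> pool S k U \<Longrightarrow> (k < n \<Longrightarrow> card U = 6) \<Longrightarrow>
    amortized (missing_mins S0) close_bound \<Delta> S"
proof (induction "card U + (n - k)" arbitrary: \<Delta> S k U rule: less_induct)
  case less
  note pool = \<open>pool S k U\<close> and full = less.prems(5)
  have \<Gamma>: "GGT n r s \<subseteq> \<Delta>" using less.prems by (simp add: extends_def)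
  have sub: "S0 \<subseteq> S" using less.prems by simp
  show ?case
  proof (cases "up \<Delta> S")
    case True
    then show ?thesis using less.prems close_bound_ge unfolding pool_def by (intro amortized_up) auto
  next
    case nup: False
    show ?thesis
    proof (cases "\<forall>u\<in>U. available_min \<Delta> S0 k u")
      case True
      then have "available_min \<Delta> S k u" if "u \<in> U" for u
        using that sub available_min_mono by blast
      then obtain t where "refutes \<Delta> S t" "proof_size t \<le> close_bound"
        using pool_close[OF pool less.prems(2) n full] by blast
      then show ?thesis by (rule amortizedI)
    next
      case False
      then obtain u0 where u0: "u0 \<in> U" "\<not> available_min \<Delta> S0 k u0" by blast
      then have "u0 < k" "k \<le> n" using pool unfolding pool_def by auto
      moreover have "k \<noteq> n" using u0 available_min_n[OF \<Gamma>] \<open>u0 < k\<close> by auto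
      ultimately have kn: "k < n" by simp
      let ?P = "\<lambda>k' m. k \<le> k' \<and> k' < n \<and> m < k' \<and> (m \<in> U \<or> k \<le> m) \<and> \<not> available_min \<Delta> S0 k' m"
      define K where "K = {k'. \<exists>m. ?P k' m}"
      have "finite K" by (rule finite_subset[of _ "{..<n}"]) (auto simp: K_def)
      have "k \<in> K" using u0 \<open>u0 < k\<close> kn unfolding K_def by blast
      define k' where "k' = Max K"
      have "k' \<in> K" unfolding k'_def using \<open>finite K\<close> \<open>k \<in> K\<close> by (intro Max_in) auto
      then obtain m where P: "?P k' m" unfolding K_def by blast
      have maxK: "i \<le> k'" if "?P i j" for i j
        unfolding k'_def by (rule Max_ge[OF \<open>finite K\<close>]) (use that in \<open>auto simp: K_def\<close>)
      \<comment> \<open>Either \<open>Suc k'\<close> is \<open>n\<close> and the clause is an axiom,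
        or its absence would contradict the maximality of \<open>k'\<close>.\<close>
      have next_avail: "available_min \<Delta> S0 (Suc k') m'" if "m' < Suc k'" "m' \<in> U \<or> k \<le> m'" for m'
      proof (rule ccontr)
        assume no: "\<not> ?thesis"
        have "Suc k' \<noteq> n" using no available_min_n[OF \<Gamma>, of m' S0] that by auto
        then have "?P (Suc k') m'" using P that no by auto
        then have "Suc k' \<le> k'" by (rule maxK)
        then show False by simp
      qed
      have avail: "available_min \<Delta> S0 (Suc k') m" "available_min \<Delta> S0 (Suc k') k'"
        using next_avail P by auto
      \<comment> \<open>The pool is full because \<open>k < n\<close>, so at least five vertices
        remain besides \<open>m\<close>.\<close>
      have "card (U - {m}) \<ge> 3" using full[OF kn] pool_finite[OF pool] card_Diff1_le[of U m]
        by (simp add: card_Diff_singleton_if)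
      then obtain u v w where uvw: "u \<in> U - {m}" "v \<in> U - {m}" "w \<in> U - {m}" "distinct [u, v, w]"
        using three_elements[of "U - {m}"] pool_finite[OF pool] by blast
      show ?thesis
      proof (rule pool_step[OF antimono_missing_mins less.prems(2) pool _ _ _ uvw(4) nup])
        show "6 * leaf_bound + 5 \<le> close_bound" using close_bound_ge by simp
      next
        fix a b c assume abc: "{a, b, c} = {u, v, w}" "distinct [a, b, c]" "consistent (S \<union> T a b c)"
        have "{a, b, c} \<subseteq> U - {m}" using uvw unfolding abc(1) by simp
        then have mem: "a \<in> U - {m}" "b \<in> U - {m}" "c \<in> U - {m}" by auto
        have set: "settled \<Delta> S0 x y z" if "distinct_triple n x y z" for x y z
          using settled[OF that] less.prems(1) by (rule settled_mono)
        obtain t where t: "refutes \<Delta> (S \<union> T a b c) t" "proof_size t \<le> 2 * leaf_bound"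
          "available_min (\<Delta> \<union> learned t) S0 k' m"
          using learn_min[OF sub set pool less.prems(2) _ _ _ _ avail mem abc(2,3)] P by blast
        have "missing_mins S0 (\<Delta> \<union> learned t) < missing_mins S0 \<Delta>"
          using P t(3) by (intro missing_mins_less[of _ _ k' m]) auto
        then show "\<exists>t. refutes \<Delta> (S \<union> T a b c) t \<and> proof_size t + 3 \<le> close_bound \<and>
            missing_mins S0 (\<Delta> \<union> learned t) < missing_mins S0 \<Delta>"
          using t close_bound_ge by (intro exI[of _ t]) auto
      next
        fix \<Delta>' S' k'' U'
        assume "\<Delta> \<subseteq> \<Delta>'" "extends \<Delta>'" "S \<subseteq> S'" "pool S' k'' U'" "k'' < n \<Longrightarrow> card U' = 6"
          "card U' + (n - k'') < card U + (n - k)"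
        then show "amortized (missing_mins S0) close_bound \<Delta>' S'"
          using less.prems(1,3) by (intro less.hyps[of U' k'']) auto
      qed (use uvw in auto)
    qed
  qed
qed

text \<open>The outer search. Its unit cost is that of a complete inner search, in which at most
  \<open>n * n\<close> clauses are missing; this search is run with \<open>S0 = S\<close> once all
  triangles are settled under \<open>S\<close>. If no unseen vertex is left, the axioms are the
  minimum clauses of the pool. Otherwise an unsettled triangle drives a step that learns some
  triangle.\<close>

lemma amortized_triangles:
  assumes n: "0 < n"
  shows "extends \<Delta> \<Longrightarrow> pool S k U \<Longrightarrow> (k < n \<Longrightarrow> card U = 6) \<Longrightarrow>
    amortized missing_triangles (close_bound * (1 + 3 * (n * n))) \<Delta> S"
proof (induction "card U + (n - k)" arbitrary: \<Delta> S k U rule: less_induct)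
  case less
  note pool = \<open>pool S k U\<close> and full = less.prems(3)
  let ?Q = "close_bound * (1 + 3 * (n * n))"
  have \<Gamma>: "GGT n r s \<subseteq> \<Delta>" using less.prems by (simp add: extends_def)
  have Q: "close_bound \<le> ?Q" by simp
  show ?case
  proof (cases "up \<Delta> S")
    case True
    then show ?thesis using less.prems close_bound_ge Q unfolding pool_def by (intro amortized_up) auto
  next
    case nup: False
    show ?thesis
    proof (cases "\<forall>x y z. distinct_triple n x y z \<longrightarrow> settled \<Delta> S x y z")
      case True
      then have "amortized (missing_mins S) close_bound \<Delta> S"
        using less.prems n by (intro amortized_mins[of \<Delta> S \<Delta> S k U]) auto
      then obtain t where t: "refutes \<Delta> S t"
        "proof_size t \<le> close_bound * (1 + 3 * (missing_mins S \<Delta> - missing_mins S (\<Delta> \<union> learned t)))"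
        by (auto simp: amortized_def)
      note t(2)
      also have "close_bound * (1 + 3 * (missing_mins S \<Delta> - missing_mins S (\<Delta> \<union> learned t))) \<le> ?Q"
        using missing_mins_le[of S \<Delta>] by (intro mult_le_mono2 add_left_mono) simp
      finally show ?thesis using t(1) by (intro amortizedI)
    next
      case False
      then obtain i j l where ijl: "distinct_triple n i j l" "\<not> settled \<Delta> S i j l" by blast
      show ?thesis
      proof (cases "k < n")
        case False
        then have k: "k = n" using pool unfolding pool_def by simp
        have "available_min \<Delta> S k u" if "u \<in> U" for u
          using that pool available_min_n[OF \<Gamma>, of u S] unfolding k pool_def by auto
        then obtain t where "refutes \<Delta> S t" "proof_size t \<le> close_bound"
          using pool_close[OF pool less.prems(1) n full] by blast
        then show ?thesis using Q by (intro amortizedI) auto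
      next
        case kn: True
        let ?p = "r i j l"
        \<comment> \<open>Six pool vertices leave three outside \<open>j\<close>, \<open>l\<close>
          and \<open>?p\<close>. A cycle on those shares at most the vertex \<open>i\<close> with
          the triangle, hence no variable, and it misses an endpoint of the guard.\<close>
        have "card U - card {j, l, ?p} \<le> card (U - {j, l, ?p})" by (rule diff_card_le_card_Diff) simp
        moreover have "card {j, l, ?p} \<le> 3" by (simp add: card_insert_if)
        ultimately have "3 \<le> card (U - {j, l, ?p})" using full[OF kn] by simp
        then obtain u v w where uvw: "u \<in> U - {j, l, ?p}" "v \<in> U - {j, l, ?p}" "w \<in> U - {j, l, ?p}"
          "distinct [u, v, w]"
          using three_elements[of "U - {j, l, ?p}"] pool_finite[OF pool] by blast
        show ?thesis
        proof (rule pool_step[OF antimono_missing_triangles less.prems(1) pool _ _ _ uvw(4) nup])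
          show "6 * leaf_bound + 5 \<le> ?Q" using close_bound_ge Q by linarith
        next
          fix a b c assume abc: "{a, b, c} = {u, v, w}" "distinct [a, b, c]" "consistent (S \<union> T a b c)"
          have "{a, b, c} \<subseteq> U - {j, l, ?p}" using uvw unfolding abc(1) by simp
          then have mem: "a \<in> U" "b \<in> U" "c \<in> U" "{a, b, c} \<inter> {j, l, ?p} = {}" by auto
          have k: "a < k" "b < k" "c < k" "k \<le> n" using mem pool unfolding pool_def by auto
          have dt: "distinct_triple n a b c" using k abc by (auto simp: distinct_triple_def)
          have below: "S \<subseteq> literals_below n"
            using pool literals_below_mono[OF k(4)] unfolding pool_def by blast
          have d: "distinct [i, j, l]" using ijl by (auto simp: distinct_triple_def)
          have "xlit x y \<notin> S" if "x \<in> U" "x \<noteq> y" for x y using pool that unfolding pool_def by auto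
          then have "var (xlit x y) \<notin> var ` S" if "x \<in> U" "y \<in> U" "x \<noteq> y" for x y
            using that by (simp add: var_image_iff neg_xlit)
          then have 1: "var ` T a b c \<inter> var ` S = {}" using mem abc(2) by (auto simp: T_eq)
          have 2: "var ` T a b c \<inter> var ` T i j l = {}"
            using mem(4) abc(2) d by (auto simp: T_eq var_xlit_eq_iff)
          have 3: "var (xlit (r i j l) (s i j l)) \<notin> var ` T a b c"
            using mem(4) abc(2) guard_facts(3)[OF ijl(1)] by (auto simp: T_eq var_xlit_eq_iff)
          obtain t x y z where t: "refutes \<Delta> (S \<union> T a b c) t" "proof_size t \<le> 9"
            "distinct_triple n x y z" "T x y z \<notin> \<Delta>" "T x y z \<in> learned t"
            using learn_triangle[OF ijl dt abc(3) below less.prems(1) 1 2 3] by blast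
          have "missing_triangles (\<Delta> \<union> learned t) < missing_triangles \<Delta>"
            using t by (intro missing_triangles_less[of _ _ x y z]) auto
          moreover have "proof_size t + 3 \<le> ?Q" using t(2) close_bound_ge Q by linarith
          ultimately show "\<exists>t. refutes \<Delta> (S \<union> T a b c) t \<and> proof_size t + 3 \<le> ?Q \<and>
              missing_triangles (\<Delta> \<union> learned t) < missing_triangles \<Delta>"
            using t(1) by blast
        next
          fix \<Delta>' S' k'' U'
          assume "\<Delta> \<subseteq> \<Delta>'" "extends \<Delta>'" "S \<subseteq> S'" "pool S' k'' U'" "k'' < n \<Longrightarrow> card U' = 6"
            "card U' + (n - k'') < card U + (n - k)"
          then show "amortized missing_triangles ?Q \<Delta>' S'"
            by (intro less.hyps[of U' k'']) auto
        qed (use uvw in auto)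
      qed
    qed
  qed
qed

section \<open>The polynomial bound\<close>

lemma refutation_exists:
  assumes "1 < n"
  obtains R where "refutes (GGT n r s) {} R" "proof_size R \<le> 8192 * n ^ 8"
proof -
  have "pool {} 0 {}" by (simp add: pool_def consistent_def)
  then obtain k U where pool: "pool {} k U" "k < n \<longrightarrow> card U = 6" using pool_fill by blast
  have "extends (GGT n r s)" by (simp add: extends_def)
  then have "amortized missing_triangles (close_bound * (1 + 3 * (n * n))) (GGT n r s) {}"
    using pool assms by (intro amortized_triangles) auto
  then obtain R where R: "refutes (GGT n r s) {} R"
    "proof_size R \<le> close_bound * (1 + 3 * (n * n)) *
      (1 + 3 * (missing_triangles (GGT n r s) - missing_triangles (GGT n r s \<union> learned R)))"
    unfolding amortized_def by blast
  have n2: "4 \<le> n * n" using mult_le_mono[of 2 n 2 n] assms by simp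
  have n3: "8 \<le> n * n * n" using mult_le_mono[OF n2, of 2 n] assms by simp
  have "n * n \<le> n * n * n" by (simp add: assms less_imp_le)
  have lb: "leaf_bound \<le> 2 * (n * n) + 1" using card_vars by (simp add: leaf_bound_def)
  have "root_bound \<le> (2 * (n * n) + 1) + n * Suc (2 * (n * n) + 1)"
    unfolding root_bound_def using lb by (intro add_le_mono mult_le_mono2) auto
  also have "\<dots> = 2 * (n * n) + 1 + 2 * (n * n * n) + 2 * n" by (simp add: algebra_simps)
  finally have "Suc root_bound \<le> 2 * (n * n) + 2 * (n * n * n) + 2 * n + 2" by simp
  moreover have "2 * n \<le> n * n" using assms by simp
  moreover have "2 * (n * n) \<le> n * n * n" using assms by simp
  ultimately have "Suc root_bound \<le> 8 * (n * n * n)" using n2 n3 by linarith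
  then have cb: "close_bound \<le> 512 * (n * n * n)" by (simp add: close_bound_def)
  note R(2)
  \<comment> \<open>For \<open>n > 1\<close> each factor is dominated by a monomial; the constants
    multiply as 512 * 4 * 4 and the degrees add up as 3 + 2 + 3.\<close>
  also have "close_bound * (1 + 3 * (n * n)) *
      (1 + 3 * (missing_triangles (GGT n r s) - missing_triangles (GGT n r s \<union> learned R)))
    \<le> 512 * (n * n * n) * (4 * (n * n)) * (4 * (n * n * n))"
    by (intro mult_le_mono cb) (use n2 n3 missing_triangles_le[of "GGT n r s"] in linarith)+
  also have "\<dots> = 8192 * n ^ 8" by algebra
  finally show ?thesis using that R(1) by blast
qed

end

theorem theorem4:
  shows "\<exists>p :: real poly. \<forall>n::nat. n > 1 \<longrightarrow>
    (\<forall>r s :: nat \<Rightarrow> nat \<Rightarrow> nat \<Rightarrow> nat. guards n r s \<longrightarrow>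
      (\<exists>R. regWRTI_refutation (GGT n r s) R \<and>
           greedy_unit_propagating (GGT n r s) R \<and>
           real (proof_size R) \<le> poly p (real n)))"
proof (intro exI[of _ "monom 8192 8"] allI impI)
  fix n :: nat and r s :: "nat \<Rightarrow> nat \<Rightarrow> nat \<Rightarrow> nat"
  assume n: "n > 1" and "guards n r s"
  then interpret guarded n r s by unfold_locales
  obtain R where R: "refutes (GGT n r s) {} R" "proof_size R \<le> 8192 * n ^ 8"
    using refutation_exists[OF n] .
  have "real (proof_size R) \<le> real (8192 * n ^ 8)" using R(2) by (rule of_nat_mono)
  also have "\<dots> = poly (monom 8192 8) (real n)" by (simp add: poly_monom)
  finally show "\<exists>R. regWRTI_refutation (GGT n r s) R \<and> greedy_unit_propagating (GGT n r s) R \<and>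
      real (proof_size R) \<le> poly (monom 8192 8) (real n)"
    using good_imp_greedy_refutation[OF R(1)] by blast
qed

end
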